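(* Let $\Omega \subset \mathbb{R}^n$ be compact, $\alpha>0$, and let $\mathcal{D} \in \mathbb{L}(\mathcal{M}(\Omega); C_0(\Omega))$ be defined by $\mathcal{D}\mu = \rho*\mu$, where $0 \not\equiv \rho \in C_0(\mathbb{R}^n)\cap L^2(\mathbb{R}^n)$ satisfies $\rho(-y)=\rho(y)$ for all $y$ and $\mathcal{F}[\rho]\ge 0$. Let $F: \mathcal{M}(\Omega)\to\mathbb{R}$ be convex, pre-differentiable, and $L$-smooth with respect to $\|\cdot\|_{\mathcal{D}}$ for some $L \ge 0$: $$F(\nu)-F(\mu)-\langle F'(\mu)|\nu-\mu\rangle \le \frac{L}{2}\|\nu-\mu\|_{\mathcal{D}}^2 \quad\text{for all } \nu,\mu\in\mathcal{M}(\Omega).$$ Let the step length $\tau>0$ satisfy $\tau L \le 1$, let $G(\mu) = \alpha\|\mu\|_{\mathcal{M}(\Omega)} + \delta_{\ge 0}(\mu)$, and let $\bar\mu\in\mathcal{M}(\Omega)$ satisfy $0 \in \partial[F+G](\bar\mu)$. Let $\kappa \in (0,1)$ and let $\{\mu^k\}_{k\ge1}$ be generated by the forward-backward method $\mu$FB (defined in the context) from some $\mu^0\in\mathcal{Z}(\Omega)$, with the tolerance sequence $\{\epsilon_{k+1}\}_{k\in\mathbb{N}}\subset(0,\infty)$ satisfying $$\lim_{N\to\infty}\frac1N\sum_{k=0}^{N-1}\epsilon_{k+1}=0.$$ Define the ergodic iterate $\tilde\mu^N := \frac1N\sum_{k=0}^{N-1}\mu^{k+1}$. Then $[F+G](\tilde\mu^N)\to[F+G](\bar\mu)$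 as $N \to \infty$; more precisely, for all $N \ge 1$, $$[F+G](\tilde\mu^N)\le[F+G](\bar\mu)+\frac{1}{N\tau}\Bigl((\kappa+\|\bar\mu\|_{\mathcal{M}(\Omega)})\sum_{k=0}^{N-1}\epsilon_{k+1}+\frac12\|\mu^0-\bar\mu\|_{\mathcal{D}}^2\Bigr).$$
   Context: All functions and measures are real-valued; $\mathbb{N}=\{0,1,2,\dots\}$. $\mathcal{M}(\Omega)$ is the space of finite Radon measures with the Radon (total variation) norm. $C_0(\Omega)$ (equal to $C(\Omega)$ for compact $\Omega$) is its designated predual, with dual product $\langle\phi|\mu\rangle=\int_\Omega\phi\,d\mu$. $\mathcal{Z}(\Omega)$ is the set of discrete measures (finite real combinations of Dirac measures at points of $\Omega$). $[\rho*\mu](x)=\int_\Omega\rho(x-y)\,d\mu(y)$; $\mathcal{F}$ is the Fourier transform; $\|\mu\|_{\mathcal{D}}=\sqrt{\langle\mathcal{D}\mu|\mu\rangle}$. $\delta_{\ge0}(\mu)$ equals $0$ if $\mu\ge0$ and $\infty$ otherwise. $F$ is pre-differentiable if it is Fréchet differentiable with $F'(\mu)\in C_0(\Omega)$ (identified with its canonical image in $\mathcal{M}(\Omega)^*$) for all $\mu$. For convex $H:\mathcal{M}(\Omega)\to[-\infty,\infty]$, the pre-subdifferential is $\partial H(\mu)=\{\phi\in C_0(\Omega)\mid H(\nu)-H(\mu)\ge\langle\phi|\nu-\mu\rangle\ \forall\nu\in\mathcal{M}(\Omega)\}$. Method $\mu$FB: given $\mu^0\in\mathcal{Z}(\Omega)$,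 $\tau>0$, $\kappa\in(0,1)$ and tolerances $\epsilon_{k+1}>0$, for each $k\in\mathbb{N}$ let $v^k:=F'(\mu^k)$ and let $\mu^{k+1}\in\mathcal{Z}(\Omega)$, $\mu^{k+1}\ge0$, be computed so as to satisfy $$\tau[v^k+\alpha]+\mathcal{D}(\mu^{k+1}-\mu^k)\ge-\epsilon_{k+1}\ \text{ on }\Omega,$$ $$\tau[v^k+\alpha]+\mathcal{D}(\mu^{k+1}-\mu^k)\le\epsilon_{k+1}\ \text{ on }\operatorname{supp}\mu^{k+1},$$ $$\langle\tau[v^k+\alpha]+\mathcal{D}(\mu^{k+1}-\mu^k)|\mu^{k+1}\rangle\le\kappa\epsilon_{k+1}.$$ *)

theory Defs
  imports "HOL-Analysis.Analysis"
begin

section \<open>Finite signed Borel measures\<close>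

(* Finite families of disjoint Borel subsets of A.  Taking the supremum over these gives the same
   value as the usual supremum over countable Borel partitions of A. *)
definition borel_families :: "'a::topological_space set \<Rightarrow> 'a set set set" where
  "borel_families A = {P. finite P \<and> disjoint P \<and> P \<subseteq> sets borel \<and> \<Union>P \<subseteq> A}"

definition set_variation :: "('a::topological_space set \<Rightarrow> real) \<Rightarrow> 'a set \<Rightarrow> real" where
  "set_variation m A = (SUP P\<in>borel_families A. \<Sum>B\<in>P. \<bar>m B\<bar>)"

definition is_signed_measure :: "('a::topological_space set \<Rightarrow> real) \<Rightarrow> bool" where
  "is_signed_measure m \<longleftrightarrow>
     (\<forall>A. A \<notin> sets borel \<longrightarrow> m A = 0) \<and>
     (\<forall>A::nat \<Rightarrow> 'a set. range A \<subseteq> sets borel \<longrightarrow> disjoint_family A \<longrightarrow>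
        (\<lambda>i. m (A i)) sums m (\<Union>i. A i)) \<and>
     bdd_above ((\<lambda>P. \<Sum>B\<in>P. \<bar>m B\<bar>) ` borel_families UNIV)"

lemma is_signed_measure_zero: "is_signed_measure (\<lambda>A. 0)"
  by (auto simp: is_signed_measure_def)

(* A signed measure is represented by its set function, extended by 0 to non-Borel sets so that
   equality of measures is equality in the type.  On Euclidean space every finite Borel measure
   is Radon, so no regularity condition is needed. *)
typedef (overloaded) ('a::topological_space) signed_measure =
    "{m :: 'a set \<Rightarrow> real. is_signed_measure m}"
  morphisms smeas Abs_signed_measure
  using is_signed_measure_zero by blast

setup_lifting type_definition_signed_measure

lemma is_signed_measure_bdd:
  "is_signed_measure m \<Longrightarrow> bdd_above ((\<lambda>P. \<Sum>B\<in>P. \<bar>m B\<bar>) ` borel_families A)"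
  unfolding is_signed_measure_def
  by (elim conjE, erule bdd_above_mono) (auto simp: borel_families_def)

lemma empty_in_borel_families [simp]: "{} \<in> borel_families A"
  by (simp add: borel_families_def)

lemma set_variation_upper:
  "is_signed_measure m \<Longrightarrow> P \<in> borel_families A \<Longrightarrow> (\<Sum>B\<in>P. \<bar>m B\<bar>) \<le> set_variation m A"
  unfolding set_variation_def by (intro cSUP_upper is_signed_measure_bdd)

lemma set_variation_least:
  "(\<And>P. P \<in> borel_families A \<Longrightarrow> (\<Sum>B\<in>P. \<bar>m B\<bar>) \<le> c) \<Longrightarrow> set_variation m A \<le> c"
  unfolding set_variation_def using empty_in_borel_families[of A]
  by (intro cSUP_least) (blast, blast)

lemma set_variation_nonneg: "is_signed_measure m \<Longrightarrow> 0 \<le> set_variation m A"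
  using set_variation_upper[of m "{}" A] by simp

lemma abs_le_set_variation:
  assumes "is_signed_measure m" "A \<in> sets borel"
  shows "\<bar>m A\<bar> \<le> set_variation m A"
  using set_variation_upper[OF assms(1), of "{A}" A] assms(2)
  by (simp add: borel_families_def)

lemma is_signed_measure_scale:
  assumes "is_signed_measure m" shows "is_signed_measure (\<lambda>A. c * m A)"
proof -
  have "(\<Sum>B\<in>P. \<bar>c * m B\<bar>) \<le> \<bar>c\<bar> * set_variation m UNIV" if "P \<in> borel_families UNIV" for P
    using mult_left_mono[OF set_variation_upper[OF assms that], of "\<bar>c\<bar>"]
    by (simp add: abs_mult sum_distrib_left)
  then have "bdd_above ((\<lambda>P. \<Sum>B\<in>P. \<bar>c * m B\<bar>) ` borel_families UNIV)"
    by (intro bdd_aboveI2)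
  then show ?thesis
    using assms by (auto simp: is_signed_measure_def intro!: sums_mult)
qed

lemma sum_abs_add_le:
  assumes "is_signed_measure m" "is_signed_measure n" "P \<in> borel_families A"
  shows "(\<Sum>B\<in>P. \<bar>m B + n B\<bar>) \<le> set_variation m A + set_variation n A"
proof -
  have "(\<Sum>B\<in>P. \<bar>m B + n B\<bar>) \<le> (\<Sum>B\<in>P. \<bar>m B\<bar>) + (\<Sum>B\<in>P. \<bar>n B\<bar>)"
    by (simp add: sum.distrib[symmetric] sum_mono)
  then show ?thesis
    using set_variation_upper[OF assms(1,3)] set_variation_upper[OF assms(2,3)] by linarith
qed

lemma is_signed_measure_add:
  assumes "is_signed_measure m" "is_signed_measure n"
  shows "is_signed_measure (\<lambda>A. m A + n A)"
proof -
  have "bdd_above ((\<lambda>P. \<Sum>B\<in>P. \<bar>m B + n B\<bar>) ` borel_families UNIV)"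
    by (intro bdd_aboveI2) (rule sum_abs_add_le[OF assms])
  then show ?thesis
    using assms by (auto simp: is_signed_measure_def intro!: sums_add)
qed

lemma set_variation_scale_le:
  assumes "is_signed_measure m"
  shows "set_variation (\<lambda>A. c * m A) A \<le> \<bar>c\<bar> * set_variation m A"
proof (rule set_variation_least)
  fix P :: "'a set set" assume "P \<in> borel_families A"
  from mult_left_mono[OF set_variation_upper[OF assms this], of "\<bar>c\<bar>"]
  show "(\<Sum>B\<in>P. \<bar>c * m B\<bar>) \<le> \<bar>c\<bar> * set_variation m A"
    by (simp add: abs_mult sum_distrib_left)
qed

lemma set_variation_scale:
  assumes "is_signed_measure m"
  shows "set_variation (\<lambda>A. c * m A) A = \<bar>c\<bar> * set_variation m A"
proof (cases "c = 0")
  case True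
  then show ?thesis
    using set_variation_scale_le[OF assms, of 0 A]
      set_variation_nonneg[OF is_signed_measure_zero, of A] by simp
next
  case False
  have "set_variation (\<lambda>A. inverse c * (c * m A)) A \<le> \<bar>inverse c\<bar> * set_variation (\<lambda>A. c * m A) A"
    by (rule set_variation_scale_le[OF is_signed_measure_scale[OF assms]])
  moreover have "(\<lambda>A. inverse c * (c * m A)) = m"
    using False by (simp add: fun_eq_iff)
  ultimately have "set_variation m A \<le> \<bar>inverse c\<bar> * set_variation (\<lambda>A. c * m A) A"
    by simp
  then have "\<bar>c\<bar> * set_variation m A \<le> set_variation (\<lambda>A. c * m A) A"
    using False by (simp add: abs_inverse field_simps)
  with set_variation_scale_le[OF assms, of c A] show ?thesis by simp
qed

instantiation signed_measure :: (topological_space) real_normed_vector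
begin

lift_definition zero_signed_measure :: "'a signed_measure" is "\<lambda>A. 0"
  by (rule is_signed_measure_zero)

lift_definition plus_signed_measure ::
    "'a signed_measure \<Rightarrow> 'a signed_measure \<Rightarrow> 'a signed_measure" is "\<lambda>m n A. m A + n A"
  by (rule is_signed_measure_add)

lift_definition scaleR_signed_measure ::
    "real \<Rightarrow> 'a signed_measure \<Rightarrow> 'a signed_measure" is "\<lambda>c m A. c * m A"
  by (rule is_signed_measure_scale)

definition uminus_signed_measure :: "'a signed_measure \<Rightarrow> 'a signed_measure" where
  "uminus_signed_measure \<mu> = scaleR (-1) \<mu>"

definition minus_signed_measure ::
    "'a signed_measure \<Rightarrow> 'a signed_measure \<Rightarrow> 'a signed_measure" where
  "minus_signed_measure \<mu> \<nu> = \<mu> + (- \<nu>)"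

definition norm_signed_measure :: "'a signed_measure \<Rightarrow> real" where
  "norm_signed_measure \<mu> = set_variation (smeas \<mu>) UNIV"

definition sgn_signed_measure :: "'a signed_measure \<Rightarrow> 'a signed_measure" where
  "sgn_signed_measure \<mu> = scaleR (inverse (norm \<mu>)) \<mu>"

definition dist_signed_measure :: "'a signed_measure \<Rightarrow> 'a signed_measure \<Rightarrow> real" where
  "dist_signed_measure \<mu> \<nu> = norm (\<mu> - \<nu>)"

definition uniformity_signed_measure :: "('a signed_measure \<times> 'a signed_measure) filter" where
  "uniformity_signed_measure = (INF e\<in>{0<..}. principal {(\<mu>, \<nu>). dist \<mu> \<nu> < e})"

definition open_signed_measure :: "'a signed_measure set \<Rightarrow> bool" where
  "open_signed_measure U \<longleftrightarrow>
     (\<forall>\<mu>\<in>U. eventually (\<lambda>(\<mu>', \<nu>). \<mu>' = \<mu> \<longrightarrow> \<nu> \<in> U) uniformity)"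

instance
proof
  fix a b c :: "'a signed_measure" and r s :: real
  have sm: "is_signed_measure (smeas a)" "is_signed_measure (smeas b)"
    using smeas by auto
  show "a + b + c = a + (b + c)" by transfer (simp add: add.assoc)
  show "a + b = b + a" by transfer (simp add: add.commute)
  show "0 + a = a" by transfer simp
  show "- a + a = 0" unfolding uminus_signed_measure_def by transfer simp
  show "a - b = a + - b" by (rule minus_signed_measure_def)
  show "r *\<^sub>R (a + b) = r *\<^sub>R a + r *\<^sub>R b" by transfer (simp add: algebra_simps)
  show "(r + s) *\<^sub>R a = r *\<^sub>R a + s *\<^sub>R a" by transfer (simp add: algebra_simps)
  show "r *\<^sub>R s *\<^sub>R a = (r * s) *\<^sub>R a" by transfer (simp add: algebra_simps)
  show "1 *\<^sub>R a = a" by transfer simp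
  show "sgn a = inverse (norm a) *\<^sub>R a" by (rule sgn_signed_measure_def)
  show "dist a b = norm (a - b)" by (rule dist_signed_measure_def)
  show "uniformity = (INF e\<in>{0<..}. principal {(\<mu>, \<nu>::'a signed_measure). dist \<mu> \<nu> < e})"
    by (rule uniformity_signed_measure_def)
  show "open U \<longleftrightarrow> (\<forall>\<mu>\<in>U. eventually (\<lambda>(\<mu>', \<nu>). \<mu>' = \<mu> \<longrightarrow> \<nu> \<in> U) uniformity)"
    for U :: "'a signed_measure set"
    by (rule open_signed_measure_def)
  show "(norm a = 0) = (a = 0)"
  proof
    assume n: "norm a = 0"
    have "smeas a A = 0" for A
    proof (cases "A \<in> sets borel")
      case True
      have "\<bar>smeas a A\<bar> \<le> set_variation (smeas a) UNIV"
        using set_variation_upper[OF sm(1), of "{A}" UNIV] True by (simp add: borel_families_def)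
      with n show ?thesis by (simp add: norm_signed_measure_def)
    next
      case False
      with sm(1) show ?thesis by (auto simp: is_signed_measure_def)
    qed
    then show "a = 0" by transfer (simp add: fun_eq_iff)
  next
    assume "a = 0"
    then show "norm a = 0"
      using set_variation_scale[OF is_signed_measure_zero, of 0 UNIV]
      by (simp add: norm_signed_measure_def zero_signed_measure.rep_eq)
  qed
  show "norm (a + b) \<le> norm a + norm b"
    unfolding norm_signed_measure_def plus_signed_measure.rep_eq
    by (rule set_variation_least) (rule sum_abs_add_le[OF sm])
  show "norm (r *\<^sub>R a) = \<bar>r\<bar> * norm a"
    unfolding norm_signed_measure_def scaleR_signed_measure.rep_eq
    by (rule set_variation_scale[OF sm(1)])
qed

end

definition variation :: "'a::topological_space signed_measure \<Rightarrow> 'a set \<Rightarrow> real" where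
  "variation \<mu> = set_variation (smeas \<mu>)"

lift_definition dirac :: "'a::topological_space \<Rightarrow> 'a signed_measure"
  is "\<lambda>x A. if A \<in> sets borel then indicator A x else 0"
proof -
  fix x :: 'a
  let ?m = "\<lambda>A. if A \<in> sets borel then indicator A x else (0::real)"
  have "(\<Sum>B\<in>P. \<bar>?m B\<bar>) \<le> 1" if P: "P \<in> borel_families UNIV" for P
  proof -
    have fin: "finite P" and disj: "disjoint P" and bor: "P \<subseteq> sets borel"
      using P by (auto simp: borel_families_def)
    have "(\<Sum>B\<in>P. \<bar>?m B\<bar>) = (\<Sum>B\<in>P. indicator B x)"
      using bor by (intro sum.cong) auto
    also have "\<dots> = real (card {B\<in>P. x \<in> B})"
      using fin by (simp add: indicator_def sum.If_cases Int_def)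
    also have "card {B\<in>P. x \<in> B} \<le> card {\<Union>{B\<in>P. x \<in> B}}"
    proof (rule card_mono)
      show "{B \<in> P. x \<in> B} \<subseteq> {\<Union>{B \<in> P. x \<in> B}}"
      proof
        fix B assume B: "B \<in> {B \<in> P. x \<in> B}"
        have "C = B" if "C \<in> P" "x \<in> C" for C
          using B that disj by (auto dest: disjointD)
        with B have "{B \<in> P. x \<in> B} = {B}" by auto
        then show "B \<in> {\<Union>{B \<in> P. x \<in> B}}" by simp
      qed
    qed simp
    finally show ?thesis by simp
  qed
  then have "bdd_above ((\<lambda>P. \<Sum>B\<in>P. \<bar>?m B\<bar>) ` borel_families UNIV)"
    by (intro bdd_aboveI2)
  moreover have "(\<lambda>i. ?m (A i)) sums ?m (\<Union>i. A i)"
    if A: "range A \<subseteq> sets borel" "disjoint_family A" for A :: "nat \<Rightarrow> 'a set"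
  proof -
    have "(\<lambda>i. indicator (A i) x :: real) sums indicator (\<Union>i. A i) x"
    proof (cases "\<exists>i. x \<in> A i")
      case True
      then obtain i where i: "x \<in> A i" by blast
      have "(\<lambda>j. indicator (A j) x :: real) = (\<lambda>j. if j = i then 1 else 0)"
        using A(2) i by (auto simp: disjoint_family_on_def fun_eq_iff indicator_def)
      then show ?thesis using i sums_single[of i "\<lambda>_. 1::real"] by (auto simp: indicator_def)
    qed (auto simp: indicator_def)
    moreover have "A i \<in> sets borel" for i using A(1) by auto
    moreover from this have "(\<Union>i. A i) \<in> sets borel" by auto
    ultimately show ?thesis by simp
  qed
  ultimately show "is_signed_measure ?m"
    by (auto simp: is_signed_measure_def)
qed

definition nonneg_measure :: "'a::topological_space signed_measure \<Rightarrow> bool" where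
  "nonneg_measure \<mu> \<longleftrightarrow> (\<forall>A\<in>sets borel. 0 \<le> smeas \<mu> A)"

definition msupp :: "'a::topological_space signed_measure \<Rightarrow> 'a set" where
  "msupp \<mu> = {x. \<forall>U. open U \<longrightarrow> x \<in> U \<longrightarrow> 0 < variation \<mu> U}"

(* M(Omega): the measures on the ambient space that vanish off Omega. For these, norm is the
   total variation norm of the measure on Omega. *)
definition measures_on :: "'a::topological_space set \<Rightarrow> 'a signed_measure set" where
  "measures_on \<Omega> = {\<mu>. \<forall>A\<in>sets borel. A \<inter> \<Omega> = {} \<longrightarrow> smeas \<mu> A = 0}"

definition discrete_measures_on :: "'a::topological_space set \<Rightarrow> 'a signed_measure set" where
  "discrete_measures_on \<Omega> = span (dirac ` \<Omega>)"


section \<open>Integration against signed measures\<close>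

(* Jordan decomposition: the positive part is (variation + measure) / 2, and the negative part of
   a measure is the positive part of its negative. *)
definition pos_part :: "'a::topological_space signed_measure \<Rightarrow> 'a measure" where
  "pos_part \<mu> = measure_of UNIV (sets borel) (\<lambda>A. ennreal ((variation \<mu> A + smeas \<mu> A) / 2))"

definition neg_part :: "'a::topological_space signed_measure \<Rightarrow> 'a measure" where
  "neg_part \<mu> = pos_part (- \<mu>)"

lemma signed_measure_empty:
  assumes "is_signed_measure m" shows "m {} = 0"
proof -
  have "(\<lambda>i::nat. m {}) sums m (\<Union>i::nat. {})"
  proof -
    have "range (\<lambda>i::nat. {}) \<subseteq> sets borel" "disjoint_family (\<lambda>i::nat. {})"
      by (auto simp: disjoint_family_on_def)
    then show ?thesis using assms unfolding is_signed_measure_def by blast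
  qed
  then have "(\<lambda>i::nat. m {}) \<longlonglongrightarrow> 0" by (intro summable_LIMSEQ_zero) (auto simp: sums_iff)
  then show ?thesis by (simp add: LIMSEQ_const_iff)
qed

lemma set_variation_empty:
  assumes "is_signed_measure m" shows "set_variation m {} = 0"
proof (rule antisym[OF set_variation_least set_variation_nonneg[OF assms]])
  fix P :: "'a set set" assume "P \<in> borel_families {}"
  then have "B = {}" if "B \<in> P" for B using that unfolding borel_families_def by blast
  then show "(\<Sum>B\<in>P. \<bar>m B\<bar>) \<le> 0"
    using signed_measure_empty[OF assms] by (intro sum_nonpos) auto
qed

lemma set_variation_mono:
  assumes "is_signed_measure m" "A \<subseteq> B" shows "set_variation m A \<le> set_variation m B"
  by (rule set_variation_least, rule set_variation_upper[OF assms(1)])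
     (use assms(2) in \<open>auto simp: borel_families_def\<close>)

lemma set_variation_superadditive:
  assumes m: "is_signed_measure m" and "A \<inter> B = {}"
  shows "set_variation m A + set_variation m B \<le> set_variation m (A \<union> B)"
proof -
  have *: "(\<Sum>C\<in>P. \<bar>m C\<bar>) + (\<Sum>C\<in>Q. \<bar>m C\<bar>) \<le> set_variation m (A \<union> B)"
    if P: "P \<in> borel_families A" and Q: "Q \<in> borel_families B" for P Q
  proof -
    have fin: "finite P" "finite Q" using P Q by (auto simp: borel_families_def)
    have "P \<inter> Q \<subseteq> {{}}" 
      using P Q assms(2) unfolding borel_families_def by blast
    then have "(\<Sum>C\<in>P \<inter> Q. \<bar>m C\<bar>) = 0"
      using signed_measure_empty[OF m] by (intro sum.neutral) auto
    then have "(\<Sum>C\<in>P. \<bar>m C\<bar>) + (\<Sum>C\<in>Q. \<bar>m C\<bar>) = (\<Sum>C\<in>P \<union> Q. \<bar>m C\<bar>)"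
      using sum.union_inter[OF fin, of "\<lambda>C. \<bar>m C\<bar>"] by simp
    moreover have "P \<union> Q \<in> borel_families (A \<union> B)"
    proof -
      have "disjoint (P \<union> Q)"
        using P Q assms(2) unfolding borel_families_def
        by (intro disjoint_union) (blast, blast, blast)
      then show ?thesis using P Q by (auto simp: borel_families_def)
    qed
    ultimately show ?thesis using set_variation_upper[OF m] by metis
  qed
  have "set_variation m A \<le> set_variation m (A \<union> B) - (\<Sum>C\<in>Q. \<bar>m C\<bar>)"
    if "Q \<in> borel_families B" for Q
    by (rule set_variation_least) (use *[OF _ that] in \<open>simp add: algebra_simps\<close>)
  then have "set_variation m B \<le> set_variation m (A \<union> B) - set_variation m A"
    by (intro set_variation_least) (simp add: algebra_simps)
  then show ?thesis by simp
qed

lemma set_variation_sums: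
  fixes A :: "nat \<Rightarrow> 'a::topological_space set"
  assumes m: "is_signed_measure m" and A: "range A \<subseteq> sets borel" "disjoint_family A"
  shows "(\<lambda>i. set_variation m (A i)) sums set_variation m (\<Union>i. A i)"
proof -
  have part: "(\<Sum>i<N. set_variation m (A i)) \<le> set_variation m (\<Union>i<N. A i)" for N
  proof (induction N)
    case 0
    then show ?case using set_variation_nonneg[OF m] by simp
  next
    case (Suc N)
    have "(\<Union>i<N. A i) \<inter> A N = {}"
      using A(2) unfolding disjoint_family_on_def by (auto, metis IntI UNIV_I empty_iff less_irrefl)
    from set_variation_superadditive[OF m this] Suc show ?case
      by (simp add: lessThan_Suc Un_commute)
  qed
  have part': "(\<Sum>i<N. set_variation m (A i)) \<le> set_variation m (\<Union>i. A i)" for N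
    by (rule order_trans[OF part set_variation_mono[OF m]]) auto
  have summ: "summable (\<lambda>i. set_variation m (A i))"
    by (rule summableI_nonneg_bounded[OF set_variation_nonneg[OF m] part'])
  have le1: "(\<Sum>i. set_variation m (A i)) \<le> set_variation m (\<Union>i. A i)"
    by (rule suminf_le_const[OF summ part'])
  have le2: "set_variation m (\<Union>i. A i) \<le> (\<Sum>i. set_variation m (A i))"
  proof (rule set_variation_least)
    fix P assume P: "P \<in> borel_families (\<Union>i. A i)"
    have fin: "finite P" and disj: "disjoint P" and bor: "P \<subseteq> sets borel" and sub: "\<Union>P \<subseteq> (\<Union>i. A i)"
      using P by (auto simp: borel_families_def)
    have Ab: "A i \<in> sets borel" for i using A(1) by auto
    have fam: "(\<Sum>B\<in>P. \<bar>m (B \<inter> A i)\<bar>) \<le> set_variation m (A i)" for i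
    proof -
      have "(\<Sum>C\<in>(\<lambda>B. B \<inter> A i) ` P. \<bar>m C\<bar>) = (\<Sum>B\<in>P. \<bar>m (B \<inter> A i)\<bar>)"
      proof (subst sum.reindex_nontrivial[OF fin])
        fix B C assume BC: "B \<in> P" "C \<in> P" "B \<noteq> C" "B \<inter> A i = C \<inter> A i"
        with disj have "B \<inter> C = {}" by (auto dest: disjointD)
        with BC(4) have "B \<inter> A i = {}" by auto
        then show "\<bar>m (B \<inter> A i)\<bar> = 0" using signed_measure_empty[OF m] by simp
      qed simp
      moreover have "(\<lambda>B. B \<inter> A i) ` P \<in> borel_families (A i)"
      proof -
        have "disjoint ((\<lambda>B. B \<inter> A i) ` P)"
        proof (rule disjointI)
          fix C D assume "C \<in> (\<lambda>B. B \<inter> A i) ` P" "D \<in> (\<lambda>B. B \<inter> A i) ` P" "C \<noteq> D"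
          then obtain B B' where "B \<in> P" "B' \<in> P" "C = B \<inter> A i" "D = B' \<inter> A i" "B \<noteq> B'"
            by blast
          with disj have "B \<inter> B' = {}" by (auto dest: disjointD)
          then show "C \<inter> D = {}" using \<open>C = _\<close> \<open>D = _\<close> by blast
        qed
        moreover have "(\<lambda>B. B \<inter> A i) ` P \<subseteq> sets borel"
          using bor Ab[of i] by (auto intro: sets.Int)
        ultimately show ?thesis using fin by (auto simp: borel_families_def)
      qed
      ultimately show ?thesis using set_variation_upper[OF m] by metis
    qed
    have summB: "summable (\<lambda>i. \<bar>m (B \<inter> A i)\<bar>)" if "B \<in> P" for B
    proof (rule summable_comparison_test'[OF summ])
      fix i
      have "\<bar>m (B \<inter> A i)\<bar> \<le> (\<Sum>B\<in>P. \<bar>m (B \<inter> A i)\<bar>)"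
        by (rule member_le_sum[OF that _ fin]) auto
      with fam[of i] show "norm \<bar>m (B \<inter> A i)\<bar> \<le> set_variation m (A i)" by simp
    qed
    have "\<bar>m B\<bar> \<le> (\<Sum>i. \<bar>m (B \<inter> A i)\<bar>)" if B: "B \<in> P" for B
    proof -
      have "(\<lambda>i. m (B \<inter> A i)) sums m (\<Union>i. B \<inter> A i)"
      proof -
        have "range (\<lambda>i. B \<inter> A i) \<subseteq> sets borel" using B bor Ab by auto
        moreover have "disjoint_family (\<lambda>i. B \<inter> A i)"
          using A(2) unfolding disjoint_family_on_def by blast
        ultimately show ?thesis using m unfolding is_signed_measure_def by blast
      qed
      moreover have "(\<Union>i. B \<inter> A i) = B" using sub B by auto
      ultimately have "m B = (\<Sum>i. m (B \<inter> A i))" by (simp add: sums_iff)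
      then show ?thesis using summable_rabs[OF summB[OF B]] by simp
    qed
    then have "(\<Sum>B\<in>P. \<bar>m B\<bar>) \<le> (\<Sum>B\<in>P. \<Sum>i. \<bar>m (B \<inter> A i)\<bar>)" by (rule sum_mono)
    also have "\<dots> = (\<Sum>i. \<Sum>B\<in>P. \<bar>m (B \<inter> A i)\<bar>)"
      by (rule suminf_sum[symmetric]) (rule summB)
    also have "\<dots> \<le> (\<Sum>i. set_variation m (A i))"
      by (rule suminf_le[OF fam summable_sum[OF summB] summ])
    finally show "(\<Sum>B\<in>P. \<bar>m B\<bar>) \<le> (\<Sum>i. set_variation m (A i))" .
  qed
  show ?thesis using le1 le2 summ by (simp add: sums_iff)
qed

lemma space_pos_part [simp]: "space (pos_part \<mu>) = UNIV"
  unfolding pos_part_def by (simp add: space_measure_of_conv)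

lemma sets_pos_part [simp, measurable_cong]: "sets (pos_part \<mu>) = sets borel"
proof -
  have "sets (pos_part \<mu>) = sigma_sets UNIV (sets borel)"
    unfolding pos_part_def by (rule sets_measure_of) simp
  also have "\<dots> = sets borel"
    by (rule sets.sigma_sets_eq[of borel, unfolded space_borel])
  finally show ?thesis .
qed

lemma emeasure_pos_part:
  assumes "A \<in> sets borel"
  shows "emeasure (pos_part \<mu>) A = ennreal ((variation \<mu> A + smeas \<mu> A) / 2)"
proof -
  have m: "is_signed_measure (smeas \<mu>)" using smeas by auto
  let ?p = "\<lambda>A. (variation \<mu> A + smeas \<mu> A) / 2"
  have nn: "0 \<le> ?p A" if "A \<in> sets borel" for A
    using abs_le_set_variation[OF m that] by (simp add: variation_def)
  show ?thesis
  proof (rule emeasure_measure_of[OF pos_part_def])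
    show "positive (sets (pos_part \<mu>)) (\<lambda>A. ennreal (?p A))"
      unfolding positive_def variation_def
      by (simp add: set_variation_empty[OF m] signed_measure_empty[OF m])
    show "countably_additive (sets (pos_part \<mu>)) (\<lambda>A. ennreal (?p A))"
    proof (rule countably_additiveI)
      fix A :: "nat \<Rightarrow> 'a set"
      assume "range A \<subseteq> sets (pos_part \<mu>)" and d: "disjoint_family A"
      then have A: "range A \<subseteq> sets borel" by simp
      have "(\<lambda>i. smeas \<mu> (A i)) sums smeas \<mu> (\<Union>i. A i)"
        using m A d unfolding is_signed_measure_def by blast
      then have "(\<lambda>i. ?p (A i)) sums ?p (\<Union>i. A i)"
        unfolding variation_def by (intro sums_divide sums_add set_variation_sums[OF m A d])
      then show "(\<Sum>i. ennreal (?p (A i))) = ennreal (?p (\<Union>i. A i))"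
        using A nn by (intro suminf_ennreal_eq) auto
    qed
  qed (use assms in simp_all)
qed

lemma variation_uminus: "variation (- \<mu>) A = variation \<mu> A"
proof -
  have "is_signed_measure (smeas \<mu>)" using smeas by auto
  from set_variation_scale[OF this, of "-1" A] show ?thesis
    unfolding variation_def uminus_signed_measure_def scaleR_signed_measure.rep_eq by simp
qed

lemma jordan_decomposition:
  assumes "A \<in> sets borel"
  shows "smeas \<mu> A = measure (pos_part \<mu>) A - measure (neg_part \<mu>) A"
    and "variation \<mu> A = measure (pos_part \<mu>) A + measure (neg_part \<mu>) A"
proof -
  have m: "is_signed_measure (smeas \<mu>)" using smeas by auto
  have [simp]: "smeas (- \<mu>) A = - smeas \<mu> A"
    unfolding uminus_signed_measure_def scaleR_signed_measure.rep_eq by simp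
  show "smeas \<mu> A = measure (pos_part \<mu>) A - measure (neg_part \<mu>) A"
    and "variation \<mu> A = measure (pos_part \<mu>) A + measure (neg_part \<mu>) A"
    using abs_le_set_variation[OF m assms]
    unfolding measure_def neg_part_def emeasure_pos_part[OF assms] variation_uminus
    by (simp_all add: variation_def[symmetric] field_simps)
qed

definition pairing ::
    "'a::topological_space set \<Rightarrow> ('a \<Rightarrow> real) \<Rightarrow> 'a signed_measure \<Rightarrow> real" where
  "pairing \<Omega> \<phi> \<mu> = (LINT x:\<Omega>|pos_part \<mu>. \<phi> x) - (LINT x:\<Omega>|neg_part \<mu>. \<phi> x)"

definition conv_measure ::
    "'a::real_normed_vector set \<Rightarrow> ('a \<Rightarrow> real) \<Rightarrow> 'a signed_measure \<Rightarrow> 'a \<Rightarrow> real" where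
  "conv_measure \<Omega> \<rho> \<mu> = (\<lambda>x. pairing \<Omega> (\<lambda>y. \<rho> (x - y)) \<mu>)"

(* The D-seminorm for D \<mu> = \<rho> * \<mu>. *)
definition D_norm ::
    "'a::real_normed_vector set \<Rightarrow> ('a \<Rightarrow> real) \<Rightarrow> 'a signed_measure \<Rightarrow> real" where
  "D_norm \<Omega> \<rho> \<mu> = sqrt (pairing \<Omega> (conv_measure \<Omega> \<rho> \<mu>) \<mu>)"


section \<open>The Fourier transform on L2\<close>

definition truncated_fourier ::
    "('a::euclidean_space \<Rightarrow> real) \<Rightarrow> real \<Rightarrow> 'a \<Rightarrow> complex" where
  "truncated_fourier f R \<xi> =
     (LINT x:cball 0 R|lborel. complex_of_real (f x) * cis (- 2 * pi * (x \<bullet> \<xi>)))"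

(* g represents the Fourier(-Plancherel) transform of f: the function f need not be integrable, so
   its transform is the L2 limit of the transforms of the truncations of f to balls. It is
   determined up to null sets. *)
definition is_fourier_L2 ::
    "('a::euclidean_space \<Rightarrow> real) \<Rightarrow> ('a \<Rightarrow> complex) \<Rightarrow> bool" where
  "is_fourier_L2 f g \<longleftrightarrow>
     g \<in> borel_measurable lborel \<and> integrable lborel (\<lambda>\<xi>. (cmod (g \<xi>))\<^sup>2) \<and>
     ((\<lambda>R. \<integral>\<^sup>+ \<xi>. ennreal ((cmod (truncated_fourier f R \<xi> - g \<xi>))\<^sup>2) \<partial>lborel) \<longlongrightarrow> 0) at_top"


section \<open>The optimisation problem and the method\<close>

(* F' is the Frechet derivative on M(Omega), given at every point by a function in
   C0(Omega) = C(Omega), for compact Omega. *)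
definition pre_derivative ::
    "'a::topological_space set \<Rightarrow> ('a signed_measure \<Rightarrow> real) \<Rightarrow>
     ('a signed_measure \<Rightarrow> 'a \<Rightarrow> real) \<Rightarrow> bool" where
  "pre_derivative \<Omega> F F' \<longleftrightarrow>
     (\<forall>\<mu>\<in>measures_on \<Omega>. continuous_on \<Omega> (F' \<mu>) \<and>
        (F has_derivative pairing \<Omega> (F' \<mu>)) (at \<mu> within measures_on \<Omega>))"

(* The difference is taken in ereal, where \<infinity> - \<infinity> = \<infinity>; if H \<mu> = \<infinity> and H is finite somewhere,
   the set is empty, as usual. *)
definition pre_subdifferential ::
    "'a::topological_space set \<Rightarrow> ('a signed_measure \<Rightarrow> ereal) \<Rightarrow>
     'a signed_measure \<Rightarrow> ('a \<Rightarrow> real) set" where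
  "pre_subdifferential \<Omega> H \<mu> =
     {\<phi>. continuous_on \<Omega> \<phi> \<and>
         (\<forall>\<nu>\<in>measures_on \<Omega>. H \<nu> - H \<mu> \<ge> ereal (pairing \<Omega> \<phi> (\<nu> - \<mu>)))}"

definition regulariser :: "real \<Rightarrow> 'a::topological_space signed_measure \<Rightarrow> ereal" where
  "regulariser \<alpha> \<mu> = ereal (\<alpha> * norm \<mu>) + (if nonneg_measure \<mu> then 0 else \<infinity>)"

definition objective ::
    "('a::topological_space signed_measure \<Rightarrow> real) \<Rightarrow> real \<Rightarrow> 'a signed_measure \<Rightarrow> ereal" where
  "objective F \<alpha> \<mu> = ereal (F \<mu>) + regulariser \<alpha> \<mu>"

definition muFB_residual ::
    "'a::real_normed_vector set \<Rightarrow> ('a \<Rightarrow> real) \<Rightarrow> real \<Rightarrow> real \<Rightarrow>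
     ('a signed_measure \<Rightarrow> 'a \<Rightarrow> real) \<Rightarrow> (nat \<Rightarrow> 'a signed_measure) \<Rightarrow> nat \<Rightarrow> 'a \<Rightarrow> real" where
  "muFB_residual \<Omega> \<rho> \<alpha> \<tau> F' \<mu> k x =
     \<tau> * (F' (\<mu> k) x + \<alpha>) + conv_measure \<Omega> \<rho> (\<mu> (Suc k) - \<mu> k) x"

definition muFB_sequence ::
    "'a::real_normed_vector set \<Rightarrow> ('a \<Rightarrow> real) \<Rightarrow> real \<Rightarrow> real \<Rightarrow> real \<Rightarrow> (nat \<Rightarrow> real) \<Rightarrow>
     ('a signed_measure \<Rightarrow> 'a \<Rightarrow> real) \<Rightarrow> (nat \<Rightarrow> 'a signed_measure) \<Rightarrow> bool" where
  "muFB_sequence \<Omega> \<rho> \<alpha> \<tau> \<kappa> \<epsilon> F' \<mu> \<longleftrightarrow>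
     \<mu> 0 \<in> discrete_measures_on \<Omega> \<and>
     (\<forall>k. \<mu> (Suc k) \<in> discrete_measures_on \<Omega> \<and> nonneg_measure (\<mu> (Suc k)) \<and>
        (\<forall>x\<in>\<Omega>. muFB_residual \<Omega> \<rho> \<alpha> \<tau> F' \<mu> k x \<ge> - \<epsilon> (Suc k)) \<and>
        (\<forall>x\<in>msupp (\<mu> (Suc k)). muFB_residual \<Omega> \<rho> \<alpha> \<tau> F' \<mu> k x \<le> \<epsilon> (Suc k)) \<and>
        pairing \<Omega> (muFB_residual \<Omega> \<rho> \<alpha> \<tau> F' \<mu> k) (\<mu> (Suc k)) \<le> \<kappa> * \<epsilon> (Suc k))"

definition ergodic_iterate ::
    "(nat \<Rightarrow> 'a::topological_space signed_measure) \<Rightarrow> nat \<Rightarrow> 'a signed_measure" where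
  "ergodic_iterate \<mu> N = (1 / real N) *\<^sub>R (\<Sum>k<N. \<mu> (Suc k))"

end

theory Submission
  imports Defs "HOL-Probability.Characteristic_Functions"
begin

text \<open>
  Convexity and \<open>L\<close>-smoothness of \<open>F\<close> together with the optimality conditions of step \<open>k\<close>, tested
  against \<open>\<mu> (Suc k)\<close> and the minimiser, give a descent inequality in which
  the three-point identity of the form \<open>\<langle>D\<mu>|\<nu>\<rangle>\<close> turns the proximal term into a telescoping
  sum; Jensen's inequality then passes to the ergodic iterate.

  All this needs \<open>\<langle>D\<mu>|\<nu>\<rangle>\<close> to be bilinear, symmetric and positive semidefinite.  A Riemann sum
  over a fine partition of \<open>\<Omega>\<close> is evidently linear in the measure and converges to the
  integral, which reduces these properties to finite sums, and semidefiniteness to that of the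
  matrices \<open>\<rho>(p - q)\<close>.  For the latter, the transform of \<open>\<rho>\<close> truncated to a ball is integrated
  against a Gaussian times \<open>|\<Sum>\<^sub>p c\<^sub>p exp(2\<pi>i p\<bullet>\<xi>)|\<^sup>2\<close>: Fubini's theorem yields a quadratic form in
  mollifications of \<open>\<rho>\<close>, nonnegative in the limit by \<open>F[\<rho>] \<ge> 0\<close>, and the mollification is
  removed by shrinking its width.
\<close>

section \<open>Riemann sums for the duality pairing\<close>

text \<open>A tag need not lie in its own cell and cells may be empty: cutting overlapping balls
  down to disjoint sets produces both. What matters is that each cell stays within \<open>d\<close>
  of its tag.\<close>

definition tagged_partition ::
    "'a::metric_space set \<Rightarrow> real \<Rightarrow> 'a set \<Rightarrow> ('a \<Rightarrow> 'a set) \<Rightarrow> bool" where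
  "tagged_partition \<Omega> d X B \<longleftrightarrow>
     finite X \<and> X \<subseteq> \<Omega> \<and> disjoint_family_on B X \<and> (\<Union>p\<in>X. B p) = \<Omega> \<and>
     (\<forall>p\<in>X. B p \<in> sets borel \<and> B p \<subseteq> ball p d)"

text \<open>Compactness gives finitely many balls covering \<Omega>; each new ball loses the cells
  built before it, and intersecting with \<Omega> at the end keeps everything disjoint and
  Borel.\<close>

lemma tagged_partition_exists:
  assumes "compact \<Omega>" "0 < d"
  obtains X B where "tagged_partition \<Omega> d X B"
proof -
  have "\<Omega> \<subseteq> (\<Union>p\<in>\<Omega>. ball p d)" using assms(2) by auto
  then obtain X where X: "X \<subseteq> \<Omega>" "finite X" "\<Omega> \<subseteq> (\<Union>p\<in>X. ball p d)"
    using compactE_image[OF assms(1), of \<Omega> "\<lambda>p. ball p d"] by blast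
  have "\<exists>B. disjoint_family_on B X \<and> (\<Union>p\<in>X. B p) = (\<Union>p\<in>X. ball p d) \<and>
     (\<forall>p\<in>X. B p \<in> sets borel \<and> B p \<subseteq> ball p d)"
    using X(2)
  proof induction
    case empty
    show ?case by (auto simp: disjoint_family_on_def)
  next
    case (insert q X)
    then obtain B where B: "disjoint_family_on B X" "(\<Union>p\<in>X. B p) = (\<Union>p\<in>X. ball p d)"
      "\<forall>p\<in>X. B p \<in> sets borel \<and> B p \<subseteq> ball p d" by blast
    let ?B = "B(q := ball q d - (\<Union>p\<in>X. B p))"
    have "disjoint_family_on ?B (insert q X)"
      using B(1) insert(2) unfolding disjoint_family_on_def by (auto split: if_splits)
    moreover have "(\<Union>p\<in>insert q X. ?B p) = (\<Union>p\<in>insert q X. ball p d)"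
      using B(2) insert(2) by auto
    moreover have "\<forall>p\<in>insert q X. ?B p \<in> sets borel \<and> ?B p \<subseteq> ball p d"
      using B(3) insert(1) by (auto intro!: sets.Diff sets.finite_UN)
    ultimately show ?case by blast
  qed
  then obtain B where B: "disjoint_family_on B X" "(\<Union>p\<in>X. B p) = (\<Union>p\<in>X. ball p d)"
      "\<forall>p\<in>X. B p \<in> sets borel \<and> B p \<subseteq> ball p d" by blast
  have "tagged_partition \<Omega> d X (\<lambda>p. \<Omega> \<inter> B p)"
    unfolding tagged_partition_def
    using B X assms(1) by (auto simp: disjoint_family_on_def dest: borel_compact)
  then show thesis by (rule that)
qed

lemma finite_measure_pos_part [simp]: "finite_measure (pos_part \<mu>)"
  by standard (simp add: emeasure_pos_part)

lemma finite_measure_neg_part [simp]: "finite_measure (neg_part \<mu>)"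
  unfolding neg_part_def by simp

lemma sets_neg_part [simp, measurable_cong]: "sets (neg_part \<mu>) = sets borel"
  unfolding neg_part_def by simp

lemma set_integrable_continuous_on_compact:
  fixes \<phi> :: "'a::metric_space \<Rightarrow> real"
  assumes "finite_measure M" "sets M = sets borel" "compact \<Omega>" "continuous_on \<Omega> \<phi>"
  shows "set_integrable M \<Omega> \<phi>"
proof -
  interpret finite_measure M by fact
  have "compact (\<phi> ` \<Omega>)" using assms by (intro compact_continuous_image)
  then obtain C where "\<forall>x\<in>\<Omega>. \<bar>\<phi> x\<bar> \<le> C"
    by (metis bounded_iff compact_imp_bounded imageI real_norm_def)
  moreover have "(\<lambda>x. indicator \<Omega> x *\<^sub>R \<phi> x) \<in> borel_measurable M"
    using borel_measurable_continuous_on_indicator[OF _ assms(4)] assms(2,3)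
    by (auto cong: measurable_cong_sets dest: borel_compact)
  \<comment> \<open>The integrand vanishes off \<Omega>, and for empty \<Omega> the constant
    \<open>C\<close> may be negative, hence \<open>max C 0\<close>.\<close>
  ultimately show ?thesis
    unfolding set_integrable_def by (intro integrable_const_bound[where B="max C 0"])
      (auto split: split_indicator simp: le_max_iff_disj)
qed

text \<open>On each cell \<phi> lies between \<open>\<phi> p - e\<close> and
  \<open>\<phi> p + e\<close>; integrating both bounds and adding over the cells recovers
  \<open>e\<close> times the measure of \<Omega>.\<close>

lemma riemann_sum_measure_bound:
  fixes \<phi> :: "'a::metric_space \<Rightarrow> real"
  assumes M: "finite_measure M" "sets M = sets borel" and \<Omega>: "compact \<Omega>" "continuous_on \<Omega> \<phi>"
    and P: "tagged_partition \<Omega> d X B" and osc: "\<And>p x. p \<in> X \<Longrightarrow> x \<in> B p \<Longrightarrow> \<bar>\<phi> x - \<phi> p\<bar> \<le> e"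
  shows "\<bar>(LINT x:\<Omega>|M. \<phi> x) - (\<Sum>p\<in>X. \<phi> p * measure M (B p))\<bar> \<le> e * measure M \<Omega>"
proof -
  interpret finite_measure M by fact
  note int = set_integrable_continuous_on_compact[OF M \<Omega>]
  have P': "finite X" "disjoint_family_on B X" "(\<Union>p\<in>X. B p) = \<Omega>"
    "\<And>p. p \<in> X \<Longrightarrow> B p \<in> sets M"
    using P M(2) by (auto simp: tagged_partition_def)
  have intB: "set_integrable M (B p) \<phi>" if "p \<in> X" for p
    using int P'(3,4) that by (rule_tac set_integrable_subset) auto
  have one: "\<bar>(LINT x:B p|M. \<phi> x) - \<phi> p * measure M (B p)\<bar> \<le> e * measure M (B p)"
    if "p \<in> X" for p
  proof -
    have const: "set_integrable M (B p) (\<lambda>_. c)" for c :: real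
      using P'(4)[OF that] by (simp add: set_integrable_def integrable_real_indicator less_top[symmetric])
    have c: "(LINT x:B p|M. c) = c * measure M (B p)" for c :: real
      using P'(4)[OF that] by (simp add: set_lebesgue_integral_def)
    have "(LINT x:B p|M. \<phi> x) \<le> (LINT x:B p|M. \<phi> p + e)"
      using osc[OF that] by (intro set_integral_mono intB const that) (smt (verit))
    moreover have "(LINT x:B p|M. \<phi> p - e) \<le> (LINT x:B p|M. \<phi> x)"
      using osc[OF that] by (intro set_integral_mono intB const that) (smt (verit))
    ultimately show ?thesis unfolding c by (simp add: algebra_simps)
  qed
  have "(LINT x:\<Omega>|M. \<phi> x) = (\<Sum>p\<in>X. LINT x:B p|M. \<phi> x)"
    using set_integral_finite_Union[OF P'(1,2) intB P'(4)] P'(3) by simp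
  then have "\<bar>(LINT x:\<Omega>|M. \<phi> x) - (\<Sum>p\<in>X. \<phi> p * measure M (B p))\<bar>
      \<le> (\<Sum>p\<in>X. \<bar>(LINT x:B p|M. \<phi> x) - \<phi> p * measure M (B p)\<bar>)"
    by (simp add: sum_subtractf[symmetric])
  also have "\<dots> \<le> (\<Sum>p\<in>X. e * measure M (B p))" by (intro sum_mono one)
  also have "\<dots> = e * measure M \<Omega>"
    using finite_measure_finite_Union[OF P'(1) _ P'(2)] P'(3,4)
    by (auto simp: sum_distrib_left image_subset_iff)
  finally show ?thesis .
qed

lemma is_signed_measure_smeas [simp]: "is_signed_measure (smeas \<mu>)"
  using smeas by auto

lemma variation_le_norm: "variation \<mu> A \<le> norm \<mu>"
  unfolding variation_def norm_signed_measure_def by (intro set_variation_mono) auto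

text \<open>The bound for measures is applied to both Jordan parts, whose masses on \<Omega> add up
  to the variation. In the difference of the two sums only \<open>smeas \<mu>\<close> is left, so
  the Jordan decomposition disappears.\<close>

lemma pairing_riemann_bound:
  fixes \<phi> :: "'a::metric_space \<Rightarrow> real"
  assumes \<Omega>: "compact \<Omega>" "continuous_on \<Omega> \<phi>" and "0 \<le> e"
    and P: "tagged_partition \<Omega> d X B" and osc: "\<And>p x. p \<in> X \<Longrightarrow> x \<in> B p \<Longrightarrow> \<bar>\<phi> x - \<phi> p\<bar> \<le> e"
  shows "\<bar>pairing \<Omega> \<phi> \<mu> - (\<Sum>p\<in>X. \<phi> p * smeas \<mu> (B p))\<bar> \<le> e * norm \<mu>"
proof -
  note b1 = riemann_sum_measure_bound[OF finite_measure_pos_part[of \<mu>] sets_pos_part \<Omega> P osc]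
  note b2 = riemann_sum_measure_bound[OF finite_measure_neg_part[of \<mu>] sets_neg_part \<Omega> P osc]
  have B: "B p \<in> sets borel" if "p \<in> X" for p using P that by (auto simp: tagged_partition_def)
  have "\<Omega> \<in> sets borel" using \<Omega> by (simp add: borel_compact)
  have "(\<Sum>p\<in>X. \<phi> p * smeas \<mu> (B p)) =
      (\<Sum>p\<in>X. \<phi> p * measure (pos_part \<mu>) (B p)) - (\<Sum>p\<in>X. \<phi> p * measure (neg_part \<mu>) (B p))"
    by (simp add: jordan_decomposition(1)[OF B] right_diff_distrib sum_subtractf cong: sum.cong)
  then have "\<bar>pairing \<Omega> \<phi> \<mu> - (\<Sum>p\<in>X. \<phi> p * smeas \<mu> (B p))\<bar>
      \<le> e * measure (pos_part \<mu>) \<Omega> + e * measure (neg_part \<mu>) \<Omega>"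
    unfolding pairing_def using b1 b2 by linarith
  also have "\<dots> = e * variation \<mu> \<Omega>"
    using jordan_decomposition(2)[OF \<open>\<Omega> \<in> sets borel\<close>, of \<mu>] by (simp add: distrib_left)
  also have "\<dots> \<le> e * norm \<mu>" using assms(3) by (intro mult_left_mono variation_le_norm)
  finally show ?thesis .
qed

text \<open>The cells compete in the supremum that defines the norm. That supremum runs over sets of
  sets, so empty cells, which may coincide, are dropped first to make \<open>B\<close>
  injective.\<close>

lemma sum_abs_smeas_partition_le:
  assumes P: "tagged_partition \<Omega> d X B"
  shows "(\<Sum>p\<in>X. \<bar>smeas \<mu> (B p)\<bar>) \<le> norm \<mu>"
proof -
  let ?P = "B ` {p\<in>X. B p \<noteq> {}}"
  have fin: "finite X" and disj: "disjoint_family_on B X"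
    and B: "\<And>p. p \<in> X \<Longrightarrow> B p \<in> sets borel" using P by (auto simp: tagged_partition_def)
  have inj: "inj_on B {p\<in>X. B p \<noteq> {}}"
  proof (rule inj_onI, rule ccontr)
    fix p q assume "p \<in> {p\<in>X. B p \<noteq> {}}" "q \<in> {p\<in>X. B p \<noteq> {}}" "B p = B q" "p \<noteq> q"
    then show False using disjoint_family_onD[OF disj, of p q] by simp
  qed
  have "disjoint ?P"
    using disj by (intro disjointI) (auto dest: disjoint_family_onD)
  then have "?P \<in> borel_families UNIV" using fin B by (auto simp: borel_families_def)
  then have "(\<Sum>A\<in>?P. \<bar>smeas \<mu> A\<bar>) \<le> norm \<mu>"
    unfolding norm_signed_measure_def by (intro set_variation_upper) simp
  moreover have "(\<Sum>p\<in>X. \<bar>smeas \<mu> (B p)\<bar>) = (\<Sum>p\<in>{p\<in>X. B p \<noteq> {}}. \<bar>smeas \<mu> (B p)\<bar>)"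
    using fin by (intro sum.mono_neutral_right)
      (auto simp: signed_measure_empty[OF is_signed_measure_smeas])
  ultimately show ?thesis by (simp add: sum.reindex[OF inj] o_def)
qed

text \<open>A single sequence of partitions with mesh tending to 0 serves all functions and
  measures, so limits of different Riemann sums can be combined term by term.\<close>

definition tagged_partitions ::
    "'a::metric_space set \<Rightarrow> (nat \<Rightarrow> 'a set) \<Rightarrow> (nat \<Rightarrow> 'a \<Rightarrow> 'a set) \<Rightarrow> bool" where
  "tagged_partitions \<Omega> X B \<longleftrightarrow> (\<forall>n. tagged_partition \<Omega> (inverse (real (Suc n))) (X n) (B n))"

lemma tagged_partitions_exist:
  assumes "compact \<Omega>"
  obtains X B where "tagged_partitions \<Omega> X B"
proof -
  have "\<forall>n. \<exists>X B. tagged_partition \<Omega> (inverse (real (Suc n))) X B"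
  proof
    fix n
    show "\<exists>X B. tagged_partition \<Omega> (inverse (real (Suc n))) X B"
      using tagged_partition_exists[OF assms, of "inverse (real (Suc n))"] by (metis inverse_positive_iff_positive of_nat_0_less_iff zero_less_Suc)
  qed
  then show thesis using that unfolding tagged_partitions_def by metis
qed

lemma tagged_partition_near:
  assumes "tagged_partition \<Omega> d X B" "p \<in> X" "x \<in> B p"
  shows "p \<in> \<Omega>" "x \<in> \<Omega>" "dist x p < d"
  using assms by (auto simp: tagged_partition_def dist_commute subset_eq)

lemma obtain_small_multiplier:
  fixes r a :: real
  assumes "0 < r" "0 \<le> a"
  obtains e where "0 < e" "e * a < r"
proof
  \<comment> \<open>The \<open>+ 1\<close> covers \<open>a = 0\<close>, which occurs for the zero
    measure.\<close>
  show "0 < r / (a + 1)" "r / (a + 1) * a < r"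
    using assms by (simp_all add: field_simps)
qed

text \<open>Uniform continuity on the compact set makes the oscillation of \<phi> on the cells
  smaller than any given \<open>e\<close> once the mesh is fine, and the error is then at most
  \<open>e * norm \<mu>\<close>.\<close>

lemma pairing_riemann_tendsto:
  fixes \<phi> :: "'a::metric_space \<Rightarrow> real"
  assumes \<Omega>: "compact \<Omega>" "continuous_on \<Omega> \<phi>" and P: "tagged_partitions \<Omega> X B"
  shows "(\<lambda>n. \<Sum>p\<in>X n. \<phi> p * smeas \<mu> (B n p)) \<longlonglongrightarrow> pairing \<Omega> \<phi> \<mu>"
proof (rule LIMSEQ_I)
  fix r :: real assume "0 < r"
  obtain e where e: "0 < e" "e * norm \<mu> < r"
    using obtain_small_multiplier[OF \<open>0 < r\<close> norm_ge_zero] by blast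
  from compact_uniformly_continuous[OF \<Omega>(2,1)] e(1)
  obtain d where d: "0 < d" "\<And>x y. x \<in> \<Omega> \<Longrightarrow> y \<in> \<Omega> \<Longrightarrow> dist x y < d \<Longrightarrow> \<bar>\<phi> x - \<phi> y\<bar> < e"
    unfolding uniformly_continuous_on_def dist_real_def by metis
  obtain N where N: "inverse (real (Suc N)) < d" using reals_Archimedean[OF d(1)] by blast
  have "\<bar>(\<Sum>p\<in>X n. \<phi> p * smeas \<mu> (B n p)) - pairing \<Omega> \<phi> \<mu>\<bar> < r" if "N \<le> n" for n
  proof -
    have Pn: "tagged_partition \<Omega> (inverse (real (Suc n))) (X n) (B n)"
      using P by (simp add: tagged_partitions_def)
    have "inverse (real (Suc n)) \<le> inverse (real (Suc N))" using that by simp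
    then have n: "inverse (real (Suc n)) < d" using N by (rule le_less_trans)
    have "\<bar>\<phi> x - \<phi> p\<bar> \<le> e" if "p \<in> X n" "x \<in> B n p" for p x
      using tagged_partition_near[OF Pn that]
      by (intro less_imp_le[OF d(2)] order.strict_trans[OF _ n])
    then have "\<bar>pairing \<Omega> \<phi> \<mu> - (\<Sum>p\<in>X n. \<phi> p * smeas \<mu> (B n p))\<bar> \<le> e * norm \<mu>"
      using e(1) by (intro pairing_riemann_bound[OF \<Omega> _ Pn]) auto
    with e(2) show ?thesis by linarith
  qed
  then show "\<exists>N. \<forall>n\<ge>N. norm ((\<Sum>p\<in>X n. \<phi> p * smeas \<mu> (B n p)) - pairing \<Omega> \<phi> \<mu>) < r"
    by auto
qed

lemma smeas_add [simp]: "smeas (\<mu> + \<nu>) A = smeas \<mu> A + smeas \<nu> A"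
  by (simp add: plus_signed_measure.rep_eq)

lemma smeas_scaleR [simp]: "smeas (c *\<^sub>R \<mu>) A = c * smeas \<mu> A"
  by (simp add: scaleR_signed_measure.rep_eq)

lemma smeas_uminus [simp]: "smeas (- \<mu>) A = - smeas \<mu> A"
  unfolding uminus_signed_measure_def scaleR_signed_measure.rep_eq by simp

lemma smeas_zero [simp]: "smeas 0 A = 0"
  by (simp add: zero_signed_measure.rep_eq)

lemma smeas_diff [simp]: "smeas (\<mu> - \<nu>) A = smeas \<mu> A - smeas \<nu> A"
  unfolding minus_signed_measure_def smeas_add smeas_uminus by simp

lemma smeas_sum: "smeas (\<Sum>i\<in>I. \<mu> i) A = (\<Sum>i\<in>I. smeas (\<mu> i) A)"
  by (induction I rule: infinite_finite_induct) auto

section \<open>Linearity, monotonicity and boundedness of the pairing\<close>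

context
  fixes \<Omega> :: "'a::metric_space set"
  assumes \<Omega>: "compact \<Omega>"
begin

text \<open>The Jordan parts of a difference are not the differences of the Jordan parts, so
  linearity of the integral does not give this directly. In the Riemann sums it is linearity of
  \<open>smeas\<close>, which passes to the limit.\<close>

lemma pairing_diff_measure:
  assumes "continuous_on \<Omega> \<phi>"
  shows "pairing \<Omega> \<phi> (\<mu> - \<nu>) = pairing \<Omega> \<phi> \<mu> - pairing \<Omega> \<phi> \<nu>"
proof -
  obtain X B where P: "tagged_partitions \<Omega> X B" using tagged_partitions_exist[OF \<Omega>] .
  note t = pairing_riemann_tendsto[OF \<Omega> assms P]
  from tendsto_diff[OF t[of \<mu>] t[of \<nu>]] t[of "\<mu> - \<nu>"] show ?thesis
    by (simp add: right_diff_distrib sum_subtractf LIMSEQ_unique)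
qed

lemma pairing_lincomb_fun:
  assumes "continuous_on \<Omega> \<phi>" "continuous_on \<Omega> \<psi>"
  shows "pairing \<Omega> (\<lambda>x. a * \<phi> x + b * \<psi> x) \<mu> = a * pairing \<Omega> \<phi> \<mu> + b * pairing \<Omega> \<psi> \<mu>"
proof -
  obtain X B where P: "tagged_partitions \<Omega> X B" using tagged_partitions_exist[OF \<Omega>] .
  note t = pairing_riemann_tendsto[OF \<Omega> _ P, where \<mu>=\<mu>]
  have "continuous_on \<Omega> (\<lambda>x. a * \<phi> x + b * \<psi> x)" by (intro continuous_intros assms)
  from t[OF this] tendsto_add[OF tendsto_mult_left[OF t[OF assms(1)], of a]
      tendsto_mult_left[OF t[OF assms(2)], of b]]
  show ?thesis
    by (simp add: distrib_right sum.distrib sum_distrib_left mult.assoc LIMSEQ_unique)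
qed

lemma pairing_mono:
  assumes "continuous_on \<Omega> \<phi>" "continuous_on \<Omega> \<psi>" "nonneg_measure \<mu>"
    and "\<And>x. x \<in> \<Omega> \<Longrightarrow> \<phi> x \<le> \<psi> x"
  shows "pairing \<Omega> \<phi> \<mu> \<le> pairing \<Omega> \<psi> \<mu>"
proof -
  obtain X B where P: "tagged_partitions \<Omega> X B" using tagged_partitions_exist[OF \<Omega>] .
  note t = pairing_riemann_tendsto[OF \<Omega> _ P, where \<mu>=\<mu>]
  from t[OF assms(1)] t[OF assms(2)] show ?thesis
  proof (rule LIMSEQ_le, intro exI allI impI sum_mono mult_right_mono)
    fix n p assume "p \<in> X n"
    then have "p \<in> \<Omega>" "B n p \<in> sets borel"
      using P by (auto simp: tagged_partitions_def tagged_partition_def)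
    then show "\<phi> p \<le> \<psi> p" "0 \<le> smeas \<mu> (B n p)" 
      using assms by (auto simp: nonneg_measure_def)
  qed
qed

lemma pairing_const: "pairing \<Omega> (\<lambda>_. c) \<mu> = c * smeas \<mu> \<Omega>"
  unfolding pairing_def
  by (simp add: set_lebesgue_integral_def borel_compact[OF \<Omega>] jordan_decomposition(1) right_diff_distrib
     finite_measure.emeasure_finite mult.commute)

text \<open>The estimate of a pairing by sup norm times total variation, read off from Riemann sums.
  It later controls how a convolution varies with its argument.\<close>

lemma pairing_abs_diff_le:
  assumes "continuous_on \<Omega> \<phi>" "continuous_on \<Omega> \<psi>" "0 \<le> e"
    and le: "\<And>x. x \<in> \<Omega> \<Longrightarrow> \<bar>\<phi> x - \<psi> x\<bar> \<le> e"
  shows "\<bar>pairing \<Omega> \<phi> \<mu> - pairing \<Omega> \<psi> \<mu>\<bar> \<le> e * norm \<mu>"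
proof -
  obtain X B where P: "tagged_partitions \<Omega> X B" using tagged_partitions_exist[OF \<Omega>] .
  note t = pairing_riemann_tendsto[OF \<Omega> _ P, where \<mu>=\<mu>]
  have "(\<lambda>n. \<bar>(\<Sum>p\<in>X n. \<phi> p * smeas \<mu> (B n p)) - (\<Sum>p\<in>X n. \<psi> p * smeas \<mu> (B n p))\<bar>)
      \<longlonglongrightarrow> \<bar>pairing \<Omega> \<phi> \<mu> - pairing \<Omega> \<psi> \<mu>\<bar>"
    by (intro tendsto_intros t assms)
  then show ?thesis
  proof (rule LIMSEQ_le_const2, intro exI allI impI)
    fix n
    have Pn: "tagged_partition \<Omega> (inverse (real (Suc n))) (X n) (B n)"
      using P by (simp add: tagged_partitions_def)
    have "\<bar>(\<Sum>p\<in>X n. \<phi> p * smeas \<mu> (B n p)) - (\<Sum>p\<in>X n. \<psi> p * smeas \<mu> (B n p))\<bar>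
       \<le> (\<Sum>p\<in>X n. \<bar>\<phi> p - \<psi> p\<bar> * \<bar>smeas \<mu> (B n p)\<bar>)"
      by (simp add: sum_subtractf[symmetric] left_diff_distrib[symmetric] abs_mult[symmetric])
    also have "\<dots> \<le> (\<Sum>p\<in>X n. e * \<bar>smeas \<mu> (B n p)\<bar>)"
      using Pn by (intro sum_mono mult_right_mono le) (auto simp: tagged_partition_def)
    also have "\<dots> \<le> e * norm \<mu>"
      using sum_abs_smeas_partition_le[OF Pn, of \<mu>] assms(3)
      by (simp add: sum_distrib_left[symmetric] mult_left_mono)
    finally show "\<bar>(\<Sum>p\<in>X n. \<phi> p * smeas \<mu> (B n p)) - (\<Sum>p\<in>X n. \<psi> p * smeas \<mu> (B n p))\<bar>
       \<le> e * norm \<mu>" .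
  qed
qed

end

section \<open>The bilinear form of a convolution kernel\<close>

context
  fixes \<Omega> :: "'a::euclidean_space set" and \<rho> :: "'a \<Rightarrow> real"
  assumes \<Omega>: "compact \<Omega>" and \<rho>: "continuous_on UNIV \<rho>"
begin

text \<open>The differences of points of \<Omega> form a compact set, on which \<rho> is uniformly
  continuous; replacing \<open>x\<close> by \<open>x'\<close> in either place moves the difference
  by a vector of the same length. The first bound serves continuity of the convolution, the second
  its Riemann sums.\<close>

lemma kernel_uniformly_continuous:
  assumes "0 < e"
  obtains d where "0 < d" "\<And>x x' y. x \<in> \<Omega> \<Longrightarrow> x' \<in> \<Omega> \<Longrightarrow> y \<in> \<Omega> \<Longrightarrow> dist x x' < d \<Longrightarrow>
    \<bar>\<rho> (x - y) - \<rho> (x' - y)\<bar> \<le> e \<and> \<bar>\<rho> (y - x) - \<rho> (y - x')\<bar> \<le> e"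
proof -
  have "compact {x - y |x y. x \<in> \<Omega> \<and> y \<in> \<Omega>}" using \<Omega> \<Omega> by (rule compact_differences)
  from compact_uniformly_continuous[OF continuous_on_subset[OF \<rho> subset_UNIV] this]
  have "\<exists>d>0. \<forall>u\<in>{x - y |x y. x \<in> \<Omega> \<and> y \<in> \<Omega>}. \<forall>v\<in>{x - y |x y. x \<in> \<Omega> \<and> y \<in> \<Omega>}.
      dist v u < d \<longrightarrow> dist (\<rho> v) (\<rho> u) < e"
    using assms unfolding uniformly_continuous_on_def by (elim allE impE)
  then obtain d where d: "0 < d" and
    c: "\<And>u v. u \<in> {x - y |x y. x \<in> \<Omega> \<and> y \<in> \<Omega>} \<Longrightarrow> v \<in> {x - y |x y. x \<in> \<Omega> \<and> y \<in> \<Omega>} \<Longrightarrow> 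
      dist u v < d \<Longrightarrow> \<bar>\<rho> u - \<rho> v\<bar> < e"
    unfolding dist_real_def by blast
  show thesis
  proof (rule that[OF d], intro conjI)
    fix x x' y assume *: "x \<in> \<Omega>" "x' \<in> \<Omega>" "y \<in> \<Omega>" "dist x x' < d"
    show "\<bar>\<rho> (x - y) - \<rho> (x' - y)\<bar> \<le> e" 
      using * by (intro less_imp_le c) (blast, blast, simp add: dist_norm)
    show "\<bar>\<rho> (y - x) - \<rho> (y - x')\<bar> \<le> e"
      using * by (intro less_imp_le c) (blast, blast, simp add: dist_norm norm_minus_commute)
  qed
qed

lemma continuous_on_kernel: "continuous_on A (\<lambda>y. \<rho> (x - y))"
  by (intro continuous_on_compose2[OF \<rho>] continuous_intros) auto

lemma conv_measure_osc:
  assumes "x \<in> \<Omega>" "x' \<in> \<Omega>" "0 \<le> e" "\<And>y. y \<in> \<Omega> \<Longrightarrow> \<bar>\<rho> (x - y) - \<rho> (x' - y)\<bar> \<le> e"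
  shows "\<bar>conv_measure \<Omega> \<rho> \<mu> x - conv_measure \<Omega> \<rho> \<mu> x'\<bar> \<le> e * norm \<mu>"
  unfolding conv_measure_def using assms
  by (intro pairing_abs_diff_le[OF \<Omega>] continuous_on_kernel) auto

text \<open>A modulus of continuity for \<rho> yields one for the convolution, scaled by the norm of
  \<mu>. Continuity lets the convolution be paired by Riemann sums in turn.\<close>

lemma continuous_on_conv_measure: "continuous_on \<Omega> (conv_measure \<Omega> \<rho> \<mu>)"
  unfolding continuous_on_iff
proof (intro ballI allI impI)
  fix x and r :: real assume x: "x \<in> \<Omega>" and "0 < r"
  obtain e where e: "0 < e" "e * norm \<mu> < r"
    using obtain_small_multiplier[OF \<open>0 < r\<close> norm_ge_zero] by blast
  obtain d where d: "0 < d" "\<And>x x' y. x \<in> \<Omega> \<Longrightarrow> x' \<in> \<Omega> \<Longrightarrow> y \<in> \<Omega> \<Longrightarrow> dist x x' < d \<Longrightarrow>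
    \<bar>\<rho> (x - y) - \<rho> (x' - y)\<bar> \<le> e" using kernel_uniformly_continuous[OF e(1)] by metis
  have "dist (conv_measure \<Omega> \<rho> \<mu> x') (conv_measure \<Omega> \<rho> \<mu> x) < r"
    if "x' \<in> \<Omega>" "dist x' x < d" for x'
  proof -
    have "\<bar>conv_measure \<Omega> \<rho> \<mu> x' - conv_measure \<Omega> \<rho> \<mu> x\<bar> \<le> e * norm \<mu>"
      using x that e(1) by (intro conv_measure_osc d(2)) auto
    with e(2) show ?thesis by (simp add: dist_real_def)
  qed
  with d(1) show "\<exists>d>0. \<forall>x'\<in>\<Omega>. dist x' x < d \<longrightarrow>
      dist (conv_measure \<Omega> \<rho> \<mu> x') (conv_measure \<Omega> \<rho> \<mu> x) < r" by blast
qed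

text \<open>Both integrals are discretised on the same partition. The inner Riemann sum differs from
  the convolution by at most \<open>e * norm \<mu>\<close> uniformly in the tag \<open>p\<close>,
  and the outer weights have absolute sum at most \<open>norm \<nu>\<close>.\<close>

lemma conv_pairing_riemann_tendsto:
  assumes P: "tagged_partitions \<Omega> X B"
  shows "(\<lambda>n. \<Sum>p\<in>X n. \<Sum>q\<in>X n. smeas \<nu> (B n p) * smeas \<mu> (B n q) * \<rho> (p - q))
     \<longlonglongrightarrow> pairing \<Omega> (conv_measure \<Omega> \<rho> \<mu>) \<nu>"
proof -
  let ?c = "conv_measure \<Omega> \<rho> \<mu>"
  have "(\<lambda>n. (\<Sum>p\<in>X n. ?c p * smeas \<nu> (B n p))
      - (\<Sum>p\<in>X n. \<Sum>q\<in>X n. smeas \<nu> (B n p) * smeas \<mu> (B n q) * \<rho> (p - q))) \<longlonglongrightarrow> 0"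
  proof (rule LIMSEQ_I)
    fix r :: real assume "0 < r"
    obtain e where e: "0 < e" "e * (norm \<mu> * norm \<nu>) < r"
      using obtain_small_multiplier[OF \<open>0 < r\<close> mult_nonneg_nonneg[OF norm_ge_zero norm_ge_zero]] by blast
    obtain d where d: "0 < d" "\<And>x x' y. x \<in> \<Omega> \<Longrightarrow> x' \<in> \<Omega> \<Longrightarrow> y \<in> \<Omega> \<Longrightarrow> dist x x' < d \<Longrightarrow>
      \<bar>\<rho> (y - x) - \<rho> (y - x')\<bar> \<le> e" using kernel_uniformly_continuous[OF e(1)] by metis
    obtain N where N: "inverse (real (Suc N)) < d" using reals_Archimedean[OF d(1)] by blast
    have "\<bar>(\<Sum>p\<in>X n. ?c p * smeas \<nu> (B n p))
      - (\<Sum>p\<in>X n. \<Sum>q\<in>X n. smeas \<nu> (B n p) * smeas \<mu> (B n q) * \<rho> (p - q))\<bar> < r"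
      if "N \<le> n" for n
    proof -
      have Pn: "tagged_partition \<Omega> (inverse (real (Suc n))) (X n) (B n)"
        using P by (simp add: tagged_partitions_def)
      have "inverse (real (Suc n)) \<le> inverse (real (Suc N))" using that by simp
      then have n: "inverse (real (Suc n)) < d" using N by (rule le_less_trans)
      have c: "\<bar>?c p - (\<Sum>q\<in>X n. \<rho> (p - q) * smeas \<mu> (B n q))\<bar> \<le> e * norm \<mu>"
        if "p \<in> X n" for p
        unfolding conv_measure_def
      proof (rule pairing_riemann_bound[OF \<Omega> continuous_on_kernel less_imp_le[OF e(1)] Pn])
        fix q y assume "q \<in> X n" "y \<in> B n q"
        note q = tagged_partition_near[OF Pn this]
        have "p \<in> \<Omega>" using Pn that by (auto simp: tagged_partition_def)
        then show "\<bar>\<rho> (p - y) - \<rho> (p - q)\<bar> \<le> e"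
          using q by (intro d(2) order.strict_trans[OF _ n])
      qed
      have "\<bar>(\<Sum>p\<in>X n. ?c p * smeas \<nu> (B n p))
        - (\<Sum>p\<in>X n. \<Sum>q\<in>X n. smeas \<nu> (B n p) * smeas \<mu> (B n q) * \<rho> (p - q))\<bar>
        = \<bar>\<Sum>p\<in>X n. (?c p - (\<Sum>q\<in>X n. \<rho> (p - q) * smeas \<mu> (B n q))) * smeas \<nu> (B n p)\<bar>"
        unfolding sum_subtractf[symmetric] left_diff_distrib sum_distrib_right by (simp add: mult_ac)
      also have "\<dots> \<le> (\<Sum>p\<in>X n. \<bar>?c p - (\<Sum>q\<in>X n. \<rho> (p - q) * smeas \<mu> (B n q))\<bar> * \<bar>smeas \<nu> (B n p)\<bar>)"
        unfolding abs_mult[symmetric] by (rule sum_abs)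
      also have "\<dots> \<le> (\<Sum>p\<in>X n. e * norm \<mu> * \<bar>smeas \<nu> (B n p)\<bar>)"
        by (intro sum_mono mult_right_mono c) auto
      also have "\<dots> \<le> e * norm \<mu> * norm \<nu>"
        using sum_abs_smeas_partition_le[OF Pn, of \<nu>] e(1)
        by (simp add: sum_distrib_left[symmetric] mult_left_mono)
      finally show ?thesis using e(2) by (simp add: mult.assoc)
    qed
    then show "\<exists>N. \<forall>n\<ge>N. norm ((\<Sum>p\<in>X n. ?c p * smeas \<nu> (B n p))
      - (\<Sum>p\<in>X n. \<Sum>q\<in>X n. smeas \<nu> (B n p) * smeas \<mu> (B n q) * \<rho> (p - q)) - 0) < r"
      by auto
  qed
  from tendsto_diff[OF pairing_riemann_tendsto[OF \<Omega> continuous_on_conv_measure P, of \<mu> \<nu>] this]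
  show ?thesis by simp
qed

text \<open>Swapping a finite double sum takes the place of Fubini's theorem for signed measures;
  evenness gives \<open>\<rho> (p - q) = \<rho> (q - p)\<close>.\<close>

lemma conv_pairing_sym:
  assumes "\<And>y. \<rho> (- y) = \<rho> y"
  shows "pairing \<Omega> (conv_measure \<Omega> \<rho> \<mu>) \<nu> = pairing \<Omega> (conv_measure \<Omega> \<rho> \<nu>) \<mu>"
proof -
  obtain X B where P: "tagged_partitions \<Omega> X B" using tagged_partitions_exist[OF \<Omega>] .
  have "\<rho> (p - q) = \<rho> (q - p)" for p q using assms[of "p - q"] by simp
  then have "(\<Sum>p\<in>X n. \<Sum>q\<in>X n. smeas \<nu> (B n p) * smeas \<mu> (B n q) * \<rho> (p - q))
    = (\<Sum>p\<in>X n. \<Sum>q\<in>X n. smeas \<mu> (B n p) * smeas \<nu> (B n q) * \<rho> (p - q))" for n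
    by (subst sum.swap) (simp add: mult_ac)
  with conv_pairing_riemann_tendsto[OF P, of \<nu> \<mu>] conv_pairing_riemann_tendsto[OF P, of \<mu> \<nu>]
  show ?thesis by (simp add: LIMSEQ_unique)
qed

text \<open>With both measures equal, each double Riemann sum is the quadratic form of the kernel
  with coefficients \<open>smeas \<mu> (B n p)\<close>.\<close>

lemma conv_pairing_nonneg:
  assumes "\<And>X c. finite X \<Longrightarrow> 0 \<le> (\<Sum>p\<in>X. \<Sum>q\<in>X. c p * c q * \<rho> (p - q))"
  shows "0 \<le> pairing \<Omega> (conv_measure \<Omega> \<rho> \<mu>) \<mu>"
proof -
  obtain X B where P: "tagged_partitions \<Omega> X B" using tagged_partitions_exist[OF \<Omega>] .
  have fin: "finite (X n)" for n using P by (auto simp: tagged_partitions_def tagged_partition_def)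
  show ?thesis
    by (rule LIMSEQ_le_const[OF conv_pairing_riemann_tendsto[OF P]]) (use assms[OF fin] in auto)
qed

end

section \<open>Positive definiteness from a nonnegative Fourier transform\<close>

lemma
  fixes f :: "'a::euclidean_space \<Rightarrow> 'b::{banach, second_countable_topology}"
  assumes [measurable]: "f \<in> borel_measurable borel" and c: "c \<noteq> 0"
  shows lborel_integrable_affine:
      "integrable lborel (\<lambda>x. f (t + c *\<^sub>R x)) \<longleftrightarrow> integrable lborel f"
    and lborel_integral_affine:
      "(\<integral>x. f (t + c *\<^sub>R x) \<partial>lborel) = (1 / \<bar>c\<bar> ^ DIM('a)) *\<^sub>R (\<integral>x. f x \<partial>lborel)"
proof -
  have "integrable lborel f \<longleftrightarrow> integrable lborel (\<lambda>x. \<bar>c\<bar> ^ DIM('a) *\<^sub>R f (t + c *\<^sub>R x))"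
    by (subst lborel_affine[OF c, of t])
       (simp add: integrable_density integrable_distr_eq)
  also have "\<dots> \<longleftrightarrow> integrable lborel (\<lambda>x. f (t + c *\<^sub>R x))"
    using c integrable_scaleR_right[of "1 / \<bar>c\<bar> ^ DIM('a)" lborel "\<lambda>x. \<bar>c\<bar> ^ DIM('a) *\<^sub>R f (t + c *\<^sub>R x)"]
    by auto
  finally show "integrable lborel (\<lambda>x. f (t + c *\<^sub>R x)) \<longleftrightarrow> integrable lborel f" ..
  have "(\<integral>x. f x \<partial>lborel) = \<bar>c\<bar> ^ DIM('a) *\<^sub>R (\<integral>x. f (t + c *\<^sub>R x) \<partial>lborel)"
    by (subst lborel_affine[OF c, of t])
       (simp add: integral_density integral_distr)
  then show "(\<integral>x. f (t + c *\<^sub>R x) \<partial>lborel) = (1 / \<bar>c\<bar> ^ DIM('a)) *\<^sub>R (\<integral>x. f x \<partial>lborel)"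
    using c by simp
qed

lemma
  fixes f :: "'a::euclidean_space \<Rightarrow> real \<Rightarrow> 'b::{real_normed_field, banach, second_countable_topology}"
  assumes f: "\<And>b. b \<in> Basis \<Longrightarrow> integrable lborel (f b)"
  shows lborel_integrable_prod: "integrable lborel (\<lambda>x. \<Prod>b\<in>Basis. f b (x \<bullet> b))"
    and lborel_integral_prod:
      "(\<integral>x. (\<Prod>b\<in>Basis. f b (x \<bullet> b)) \<partial>lborel) = (\<Prod>b\<in>Basis. \<integral>x. f b x \<partial>lborel)"
proof -
  interpret product_sigma_finite "\<lambda>_::'a. lborel :: real measure" ..
  have meas: "f b \<in> borel_measurable borel" if "b \<in> Basis" for b
    using borel_measurable_integrable[OF f[OF that]] by simp
  have *: "(\<lambda>x::'a. \<Prod>b\<in>Basis. f b (x \<bullet> b)) \<in> borel_measurable borel"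
  proof (rule borel_measurable_prod)
    fix b :: 'a assume "b \<in> Basis"
    then show "(\<lambda>x. f b (x \<bullet> b)) \<in> borel_measurable borel"
      by (intro measurable_compose[OF _ meas]) simp
  qed
  have "integrable (Pi\<^sub>M Basis (\<lambda>_::'a. lborel)) (\<lambda>x. \<Prod>b\<in>Basis. f b (x b))"
    by (rule product_integrable_prod) (simp_all add: f)
  then show "integrable lborel (\<lambda>x::'a. \<Prod>b\<in>Basis. f b (x \<bullet> b))"
    by (subst lborel_eq, subst integrable_distr_eq[OF _ *]) (simp_all cong: prod.cong)
  show "(\<integral>x. (\<Prod>b\<in>Basis. f b (x \<bullet> b)) \<partial>lborel) = (\<Prod>b\<in>Basis. \<integral>x. f b x \<partial>lborel)"
    by (subst lborel_eq, subst integral_distr[OF _ *])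
       (simp_all add: product_integral_prod[symmetric] f cong: prod.cong)
qed

section \<open>Gaussian weights and their Fourier transform\<close>

definition gauss :: "'a::euclidean_space \<Rightarrow> real" where
  "gauss x = (\<Prod>b\<in>Basis. std_normal_density (x \<bullet> b))"

lemma exp_norm_eq_prod:
  fixes x :: "'a::euclidean_space"
  shows "exp (- (norm x)\<^sup>2 / 2) = (\<Prod>b\<in>Basis. exp (- (x \<bullet> b)\<^sup>2 / 2))"
proof -
  have "(norm x)\<^sup>2 = (\<Sum>b\<in>Basis. (x \<bullet> b)\<^sup>2)"
    unfolding power2_norm_eq_inner by (subst euclidean_inner) (simp add: power2_eq_square)
  then show ?thesis
    by (simp add: exp_sum[symmetric] sum_negf sum_divide_distrib)
qed

text \<open>The product form in the definition lets integrals factor over the basis; this radial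
  form gives positivity and boundedness and lets the transform be recognised as a Gaussian
  again.\<close>

lemma gauss_eq: "gauss (x::'a::euclidean_space) = (1 / sqrt (2 * pi)) ^ DIM('a) * exp (- (norm x)\<^sup>2 / 2)"
  unfolding exp_norm_eq_prod gauss_def std_normal_density_def prod.distrib by simp

lemma gauss_pos: "0 < gauss x"
  unfolding gauss_eq by simp

lemma gauss_le_1: "gauss (x::'a::euclidean_space) \<le> 1"
proof -
  have "(1 / sqrt (2 * pi)) ^ DIM('a) \<le> 1"
    using pi_ge_two by (intro power_le_one) (auto simp: real_le_rsqrt)
  then show ?thesis unfolding gauss_eq by (intro mult_le_one) auto
qed

lemma borel_measurable_gauss [measurable]: "gauss \<in> borel_measurable borel"
  unfolding gauss_eq[abs_def] by measurable

lemma integrable_gauss: "integrable lborel gauss"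
  unfolding gauss_def[abs_def] by (intro lborel_integrable_prod) simp

lemma integral_gauss: "(\<integral>x. gauss x \<partial>lborel) = 1"
  unfolding gauss_def by (subst lborel_integral_prod) simp_all

text \<open>The integral is the characteristic function of the standard normal distribution at
  \<open>t\<close>.\<close>

lemma fourier_std_normal_density:
  "(\<integral>u. complex_of_real (std_normal_density u) * cis (t * u) \<partial>lborel) = exp (- (t\<^sup>2) / 2)"
proof -
  have "char std_normal_distribution t
      = (\<integral>u. std_normal_density u *\<^sub>R cis (t * u) \<partial>lborel)"
    unfolding char_def by (subst integral_density) (auto simp: cis_conv_exp)
  then show ?thesis
    by (simp add: char_std_normal_distribution scaleR_conv_of_real)
qed

text \<open>Both the weight and the character \<open>cis (z \<bullet> \<xi>)\<close> are products
  over the basis, so the integral splits into one-dimensional characteristic functions.\<close>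

lemma fourier_gauss:
  fixes z :: "'a::euclidean_space"
  shows "(\<integral>\<xi>. complex_of_real (gauss \<xi>) * cis (z \<bullet> \<xi>) \<partial>lborel) = exp (- (norm z)\<^sup>2 / 2)"
proof -
  have cis: "cis (z \<bullet> \<xi>) = (\<Prod>b\<in>Basis. cis ((z \<bullet> b) * (\<xi> \<bullet> b)))" for \<xi>
    by (simp add: cis_conv_exp exp_sum[symmetric] euclidean_inner[of z \<xi>] sum_distrib_left)
  have int: "integrable lborel (\<lambda>u. complex_of_real (std_normal_density u) * cis (t * u))" for t
    by (rule Bochner_Integration.integrable_bound[of _ std_normal_density])
       (auto simp: norm_mult cis_conv_exp)
  have "(\<integral>\<xi>. complex_of_real (gauss \<xi>) * cis (z \<bullet> \<xi>) \<partial>lborel)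
      = (\<integral>\<xi>. (\<Prod>b\<in>Basis. complex_of_real (std_normal_density (\<xi> \<bullet> b)) * cis ((z \<bullet> b) * (\<xi> \<bullet> b))) \<partial>lborel)"
    by (simp add: gauss_def cis prod.distrib)
  also have "\<dots> = (\<Prod>b\<in>Basis. complex_of_real (exp (- ((z \<bullet> b)\<^sup>2) / 2)))"
    using int by (subst lborel_integral_prod[where f =
        "\<lambda>b u. complex_of_real (std_normal_density u) * cis ((z \<bullet> b) * u)"])
      (simp_all add: fourier_std_normal_density)
  also have "\<dots> = exp (- (norm z)\<^sup>2 / 2)"
    by (simp only: exp_norm_eq_prod of_real_prod)
  finally show ?thesis .
qed

lemma integrable_gauss_scaled:
  "0 < k \<Longrightarrow> integrable lborel (\<lambda>x::'a::euclidean_space. gauss (k *\<^sub>R x))"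
  using lborel_integrable_affine[of "gauss :: 'a \<Rightarrow> real" k 0] integrable_gauss by simp

text \<open>Substitute \<open>(2 * pi * \<sigma>) *\<^sub>R \<xi>\<close> for the variable of
  integration. The scale of the weight is chosen so that its transform is a Gaussian of width
  \<sigma>.\<close>

lemma fourier_gauss_scaled:
  fixes z :: "'a::euclidean_space"
  assumes "0 < \<sigma>"
  shows "(\<integral>\<xi>. complex_of_real (gauss ((2 * pi * \<sigma>) *\<^sub>R \<xi>)) * cis (2 * pi * (z \<bullet> \<xi>)) \<partial>lborel)
    = complex_of_real ((1 / (2 * pi * \<sigma>)) ^ DIM('a) * exp (- (norm (z /\<^sub>R \<sigma>))\<^sup>2 / 2))"
proof -
  have "(\<integral>\<xi>. complex_of_real (gauss ((2 * pi * \<sigma>) *\<^sub>R \<xi>)) * cis (2 * pi * (z \<bullet> \<xi>)) \<partial>lborel)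
    = (\<integral>\<xi>. (\<lambda>\<eta>. complex_of_real (gauss \<eta>) * cis ((z /\<^sub>R \<sigma>) \<bullet> \<eta>)) (0 + (2 * pi * \<sigma>) *\<^sub>R \<xi>) \<partial>lborel)"
    using assms by (simp add: field_simps)
  also have "\<dots> = complex_of_real ((1 / (2 * pi * \<sigma>)) ^ DIM('a) * exp (- (norm (z /\<^sub>R \<sigma>))\<^sup>2 / 2))"
    using assms
    by (subst lborel_integral_affine)
       (simp_all only: fourier_gauss, simp_all add: scaleR_conv_of_real power_divide cis_conv_exp)
  finally show ?thesis .
qed

text \<open>With real coefficients, conjugation only flips the sign of the phases, and multiplying
  out leaves phases that depend on \<open>p - q\<close>. This is where the arguments of the kernel
  matrix come from.\<close>

lemma cmod_sum_cis_squared: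
  fixes c :: "'a::euclidean_space \<Rightarrow> real"
  shows "complex_of_real ((cmod (\<Sum>p\<in>X. c p * cis (2 * pi * (p \<bullet> \<xi>))))\<^sup>2)
    = (\<Sum>p\<in>X. \<Sum>q\<in>X. complex_of_real (c p * c q) * cis (2 * pi * ((p - q) \<bullet> \<xi>)))"
proof -
  have "complex_of_real (c p) * cis (2 * pi * (p \<bullet> \<xi>)) * (complex_of_real (c q) * cis (- (2 * pi * (q \<bullet> \<xi>))))
      = complex_of_real (c p * c q) * cis (2 * pi * ((p - q) \<bullet> \<xi>))" for p q
  proof -
    have "complex_of_real (c p) * cis (2 * pi * (p \<bullet> \<xi>)) * (complex_of_real (c q) * cis (- (2 * pi * (q \<bullet> \<xi>))))
      = complex_of_real (c p * c q) * (cis (2 * pi * (p \<bullet> \<xi>)) * cis (- (2 * pi * (q \<bullet> \<xi>))))"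
      by simp
    then show ?thesis by (simp only: cis_mult inner_diff_left) (simp add: algebra_simps)
  qed
  then show ?thesis
    unfolding complex_norm_square cnj_sum complex_cnj_mult cis_cnj complex_cnj_complex_of_real sum_product
    by (simp only:)
qed

section \<open>Testing the Fourier transform against nonnegative weights\<close>

lemma borel_measurable_cis: "cis \<in> borel_measurable borel"
  by (intro borel_measurable_continuous_onI continuous_intros)

text \<open>Fubini's theorem moves the transform from \<rho> to the weight \<open>h\<close>.
  Truncation to a ball makes it applicable: a bounded \<rho> is integrable there even if it is not
  globally.\<close>

lemma weighted_fourier_integral:
  fixes \<rho> :: "'a::euclidean_space \<Rightarrow> real" and h :: "'a \<Rightarrow> real"
  assumes \<rho>[measurable]: "\<rho> \<in> borel_measurable borel" and bdd: "\<And>x. \<bar>\<rho> x\<bar> \<le> M"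
    and h: "integrable lborel h"
  shows "integrable lborel (\<lambda>\<xi>. truncated_fourier \<rho> R \<xi> * h \<xi>)"
    and "(\<integral>\<xi>. truncated_fourier \<rho> R \<xi> * h \<xi> \<partial>lborel)
      = (\<integral>x. indicator (cball 0 R) x *\<^sub>R (\<rho> x * (\<integral>\<xi>. h \<xi> * cis (- 2 * pi * (x \<bullet> \<xi>)) \<partial>lborel)) \<partial>lborel)"
proof -
  have [measurable]: "h \<in> borel_measurable borel" using h by (auto dest: borel_measurable_integrable)
  define f where "f x \<xi> = indicator (cball 0 R) x *\<^sub>R (\<rho> x * cis (- 2 * pi * (x \<bullet> \<xi>))) * h \<xi>"
    for x \<xi> :: 'a
  \<comment> \<open>The character has modulus 1, so the norm of the joint integrand is a function of
    \<open>x\<close> times a function of \<open>\<xi>\<close>.\<close>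
  have n: "norm (f x \<xi>) = (indicator (cball 0 R) x * \<bar>\<rho> x\<bar>) * \<bar>h \<xi>\<bar>" for x \<xi>
    by (simp add: f_def norm_mult)
  note [measurable] = borel_measurable_cis
  have [measurable]: "cball (0::'a) R \<in> sets borel" by simp
  have fm[measurable]: "case_prod f \<in> borel_measurable (lborel \<Otimes>\<^sub>M lborel)"
    unfolding f_def[abs_def] split_beta' by measurable
  have ind: "integrable lborel (\<lambda>x::'a. indicator (cball 0 R) x * \<bar>\<rho> x\<bar>)"
  proof (rule Bochner_Integration.integrable_bound)
    show "integrable lborel (\<lambda>x::'a. indicator (cball 0 R) x * M)"
      by (intro integrable_mult_left integrable_real_indicator) (simp_all add: emeasure_bounded_finite[unfolded infinity_ennreal_def])
    show "AE x in lborel. norm (indicator (cball 0 R) x * \<bar>\<rho> x\<bar>) \<le> norm (indicator (cball (0::'a) R) x * M)"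
      by (intro AE_I2) (simp add: order_trans[OF bdd abs_ge_self] split: split_indicator)
  qed simp
  have hn: "integrable lborel (\<lambda>\<xi>. \<bar>h \<xi>\<bar>)" using h by simp
  have int2: "integrable lborel (f x)" for x
  proof (rule Bochner_Integration.integrable_bound)
    show "integrable lborel (\<lambda>\<xi>. (indicator (cball 0 R) x * \<bar>\<rho> x\<bar>) * \<bar>h \<xi>\<bar>)"
      by (intro integrable_mult_right hn)
    show "f x \<in> borel_measurable lborel"
      using measurable_Pair2[OF fm, of x] by simp
  qed (simp add: n abs_mult)
  have fub: "integrable (lborel \<Otimes>\<^sub>M lborel) (case_prod f)"
  proof (rule lborel_pair.Fubini_integrable[OF fm])
    show "integrable lborel (\<lambda>x. \<integral>\<xi>. norm (case_prod f (x, \<xi>)) \<partial>lborel)"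
      unfolding prod.case n integral_mult_right_zero by (intro integrable_mult_left ind)
  qed (simp add: int2)
  have T: "truncated_fourier \<rho> R \<xi> * h \<xi> = (\<integral>x. f x \<xi> \<partial>lborel)" for \<xi>
    unfolding truncated_fourier_def set_lebesgue_integral_def f_def by (simp only: integral_mult_left_zero)
  show "integrable lborel (\<lambda>\<xi>. truncated_fourier \<rho> R \<xi> * h \<xi>)"
    unfolding T by (rule lborel_pair.integrable_snd[OF fub])
  have "(\<integral>\<xi>. truncated_fourier \<rho> R \<xi> * h \<xi> \<partial>lborel) = (\<integral>x. (\<integral>\<xi>. f x \<xi> \<partial>lborel) \<partial>lborel)"
    unfolding T by (rule lborel_pair.Fubini_integral[OF fub])
  also have "(\<lambda>x. \<integral>\<xi>. f x \<xi> \<partial>lborel)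
     = (\<lambda>x. indicator (cball 0 R) x *\<^sub>R (\<rho> x * (\<integral>\<xi>. h \<xi> * cis (- 2 * pi * (x \<bullet> \<xi>)) \<partial>lborel)))"
  proof
    fix x
    have "f x = (\<lambda>\<xi>. indicator (cball 0 R) x *\<^sub>R (\<rho> x * (h \<xi> * cis (- 2 * pi * (x \<bullet> \<xi>)))))"
      by (simp add: f_def fun_eq_iff)
    then show "(\<integral>\<xi>. f x \<xi> \<partial>lborel)
     = indicator (cball 0 R) x *\<^sub>R (\<rho> x * (\<integral>\<xi>. h \<xi> * cis (- 2 * pi * (x \<bullet> \<xi>)) \<partial>lborel))"
      by (simp only: integral_scaleR_right integral_mult_right_zero)
  qed
  finally show "(\<integral>\<xi>. truncated_fourier \<rho> R \<xi> * h \<xi> \<partial>lborel)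
      = (\<integral>x. indicator (cball 0 R) x *\<^sub>R (\<rho> x * (\<integral>\<xi>. h \<xi> * cis (- 2 * pi * (x \<bullet> \<xi>)) \<partial>lborel)) \<partial>lborel)" .
qed

lemma borel_measurable_truncated_fourier:
  fixes \<rho> :: "'a::euclidean_space \<Rightarrow> real"
  assumes [measurable]: "\<rho> \<in> borel_measurable borel"
  shows "truncated_fourier \<rho> R \<in> borel_measurable borel"
proof -
  note [measurable] = borel_measurable_cis
  have [measurable]: "cball (0::'a) R \<in> sets borel" by simp
  have "(\<lambda>(\<xi>, x). indicator (cball 0 R) x *\<^sub>R (complex_of_real (\<rho> x) * cis (- 2 * pi * (x \<bullet> \<xi>))))
     \<in> borel_measurable (borel \<Otimes>\<^sub>M lborel)"
    unfolding split_beta' by measurable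
  from lborel.borel_measurable_lebesgue_integral[OF this] show ?thesis
    by (simp add: truncated_fourier_def[abs_def] set_lebesgue_integral_def)
qed

text \<open>The truncated transforms may have negative real part, but they approach
  \<open>\<rho>hat\<close> in L2 and \<open>h\<close> is square integrable, so the real parts of
  their integrals against \<open>h\<close> are eventually at least \<open>- e\<close> for every
  positive \<open>e\<close>.\<close>

lemma fourier_limit_nonneg:
  fixes \<rho> :: "'a::euclidean_space \<Rightarrow> real" and h :: "'a \<Rightarrow> real"
  assumes \<rho>[measurable]: "\<rho> \<in> borel_measurable borel" and bdd: "\<And>x. \<bar>\<rho> x\<bar> \<le> M"
    and F: "is_fourier_L2 \<rho> \<rho>hat" and pos: "AE \<xi> in lborel. 0 \<le> Re (\<rho>hat \<xi>)"
    and h: "integrable lborel h" and h2: "integrable lborel (\<lambda>\<xi>. (h \<xi>)\<^sup>2)" and h0: "\<And>\<xi>. 0 \<le> h \<xi>"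
    and lim: "((\<lambda>R. Re (\<integral>\<xi>. truncated_fourier \<rho> R \<xi> * h \<xi> \<partial>lborel)) \<longlongrightarrow> A) at_top"
  shows "0 \<le> A"
proof (rule field_le_epsilon)
  fix e :: real assume "0 < e"
  define H where "H = (\<integral>\<xi>. (h \<xi>)\<^sup>2 \<partial>lborel)"
  have "0 \<le> H" unfolding H_def by simp
  \<comment> \<open>\<open>l\<close> balances two error terms: \<open>H / (2 * l)\<close> is at most
    \<open>e / 2\<close>, and so is \<open>l / 2\<close> times the squared L2 error once that is
    below \<open>e / l\<close>. The \<open>+ 1\<close> keeps \<open>l\<close> positive when
    \<open>H = 0\<close>.\<close>
  define l where "l = (H + 1) / e"
  have l: "0 < l" "H / l \<le> e" using \<open>0 < e\<close> \<open>0 \<le> H\<close> by (auto simp: l_def field_simps)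
  let ?u = "\<lambda>R \<xi>. (cmod (truncated_fourier \<rho> R \<xi> - \<rho>hat \<xi>))\<^sup>2"
  have [measurable]: "\<rho>hat \<in> borel_measurable borel" using F by (simp add: is_fourier_L2_def)
  note [measurable] = borel_measurable_truncated_fourier[OF \<rho>]
  have "((\<lambda>R. \<integral>\<^sup>+ \<xi>. ennreal (?u R \<xi>) \<partial>lborel) \<longlongrightarrow> 0) at_top"
    using F by (simp add: is_fourier_L2_def)
  then have "\<forall>\<^sub>F R in at_top. (\<integral>\<^sup>+ \<xi>. ennreal (?u R \<xi>) \<partial>lborel) < ennreal (e / l)"
    using \<open>0 < e\<close> l(1) by (intro order_tendstoD) auto
  then have "\<forall>\<^sub>F R in at_top. - e \<le> Re (\<integral>\<xi>. truncated_fourier \<rho> R \<xi> * h \<xi> \<partial>lborel)"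
  proof eventually_elim
    case (elim R)
    have u: "integrable lborel (?u R)"
      using elim by (intro integrableI_bounded) (auto intro: less_trans)
    have "ennreal (\<integral>\<xi>. ?u R \<xi> \<partial>lborel) < ennreal (e / l)"
      using elim nn_integral_eq_integral[OF u] by simp
    then have uI: "(\<integral>\<xi>. ?u R \<xi> \<partial>lborel) \<le> e / l"
      using \<open>0 < e\<close> l(1) by (subst (asm) ennreal_less_iff) auto
    note T = weighted_fourier_integral(1)[OF \<rho> bdd h, of R]
    have "0 \<le> (\<integral>\<xi>. Re (truncated_fourier \<rho> R \<xi> * h \<xi>) + (l / 2 * ?u R \<xi> + 1 / (2 * l) * (h \<xi>)\<^sup>2) \<partial>lborel)"
    proof (rule integral_nonneg_AE)
      show "AE \<xi> in lborel. 0 \<le> Re (truncated_fourier \<rho> R \<xi> * h \<xi>) + (l / 2 * ?u R \<xi> + 1 / (2 * l) * (h \<xi>)\<^sup>2)"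
        using pos
      proof eventually_elim
        case (elim \<xi>)
        define c where "c = cmod (truncated_fourier \<rho> R \<xi> - \<rho>hat \<xi>)"
        have "- c \<le> Re (truncated_fourier \<rho> R \<xi> - \<rho>hat \<xi>)"
          using abs_Re_le_cmod[of "truncated_fourier \<rho> R \<xi> - \<rho>hat \<xi>"] by (simp add: c_def)
        then have "- c * h \<xi> \<le> Re (truncated_fourier \<rho> R \<xi>) * h \<xi>"
          using elim by (intro mult_right_mono h0) simp
        \<comment> \<open>AM-GM with a large weight \<open>l\<close> takes the place of Cauchy-Schwarz\<close>
        moreover have "0 \<le> (l * c - h \<xi>)\<^sup>2 / (2 * l)" using l(1) by simp
        then have "c * h \<xi> \<le> l / 2 * c\<^sup>2 + 1 / (2 * l) * (h \<xi>)\<^sup>2"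
          using l(1) by (simp add: power2_eq_square field_simps)
        ultimately show ?case unfolding c_def by simp
      qed
    qed
    also have "\<dots> = Re (\<integral>\<xi>. truncated_fourier \<rho> R \<xi> * h \<xi> \<partial>lborel) + (l / 2 * (\<integral>\<xi>. ?u R \<xi> \<partial>lborel) + 1 / (2 * l) * H)"
    proof -
      have "integrable lborel (\<lambda>\<xi>. Re (truncated_fourier \<rho> R \<xi> * h \<xi>))" by (rule integrable_Re[OF T])
      moreover have "integrable lborel (\<lambda>\<xi>. l / 2 * ?u R \<xi>)" "integrable lborel (\<lambda>\<xi>. 1 / (2 * l) * (h \<xi>)\<^sup>2)"
        by (intro integrable_mult_right u h2)+
      ultimately show ?thesis
        unfolding H_def integral_Re[OF T, symmetric] integral_mult_right_zero[symmetric]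
        by (simp only: Bochner_Integration.integral_add Bochner_Integration.integrable_add)
    qed
    also have "\<dots> \<le> Re (\<integral>\<xi>. truncated_fourier \<rho> R \<xi> * h \<xi> \<partial>lborel) + (e / 2 + e / 2)"
    proof (intro add_left_mono add_mono)
      show "l / 2 * (\<integral>\<xi>. ?u R \<xi> \<partial>lborel) \<le> e / 2" using uI l(1) by (simp add: field_simps)
      show "1 / (2 * l) * H \<le> e / 2" using l by (simp add: field_simps)
    qed
    finally show ?case by simp
  qed
  with lim have "- e \<le> A" by (intro tendsto_lowerbound[where F=at_top]) auto
  then show "0 \<le> A + e" by simp
qed

text \<open>The value of the factor is hidden, since it is later divided out and only its sign
  matters.\<close>

lemma fourier_gauss_scaled_obtain:
  assumes "0 < \<sigma>"
  obtains K where "0 < K" "\<And>z :: 'a::euclidean_space.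
    (\<integral>\<xi>. complex_of_real (gauss ((2 * pi * \<sigma>) *\<^sub>R \<xi>)) * cis (2 * pi * (z \<bullet> \<xi>)) \<partial>lborel)
      = complex_of_real (K * gauss (z /\<^sub>R \<sigma>))"
proof
  let ?n = "DIM('a)"
  show "0 < (1 / (2 * pi * \<sigma>)) ^ ?n * sqrt (2 * pi) ^ ?n" using assms by simp
  show "(\<integral>\<xi>. complex_of_real (gauss ((2 * pi * \<sigma>) *\<^sub>R \<xi>)) * cis (2 * pi * (z \<bullet> \<xi>)) \<partial>lborel)
      = complex_of_real (((1 / (2 * pi * \<sigma>)) ^ ?n * sqrt (2 * pi) ^ ?n) * gauss (z /\<^sub>R \<sigma>))" for z :: 'a
    unfolding fourier_gauss_scaled[OF assms] gauss_eq[of "z /\<^sub>R \<sigma>"] by (simp add: power_divide)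
qed

text \<open>The test weight is a Gaussian times the squared modulus of a trigonometric polynomial.
  Its transform is a combination of Gaussians of width \<sigma> centred at the points
  \<open>p - q\<close>, so integrating \<rho> against it gives the quadratic form of \<rho> smoothed
  at scale \<sigma>.\<close>

lemma mollified_kernel_positive_definite:
  fixes \<rho> :: "'a::euclidean_space \<Rightarrow> real"
  assumes \<rho>[measurable]: "\<rho> \<in> borel_measurable borel" and bdd: "\<And>x. \<bar>\<rho> x\<bar> \<le> M"
    and F: "is_fourier_L2 \<rho> \<rho>hat" and pos: "AE \<xi> in lborel. 0 \<le> Re (\<rho>hat \<xi>)"
    and fin: "finite X" and \<sigma>: "0 < \<sigma>"
  shows "0 \<le> (\<Sum>p\<in>X. \<Sum>q\<in>X. c p * c q * (\<integral>u. \<rho> (p - q - \<sigma> *\<^sub>R u) * gauss u \<partial>lborel))"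
proof -
  define w where "w \<xi> = (cmod (\<Sum>p\<in>X. c p * cis (2 * pi * (p \<bullet> \<xi>))))\<^sup>2" for \<xi>
  define g where "g \<xi> = gauss ((2 * pi * \<sigma>) *\<^sub>R \<xi>)" for \<xi> :: 'a
  define h where "h \<xi> = g \<xi> * w \<xi>" for \<xi>
  define W where "W = (\<Sum>p\<in>X. \<bar>c p\<bar>)\<^sup>2"
  note [measurable] = borel_measurable_cis
  have [measurable]: "g \<in> borel_measurable borel" "w \<in> borel_measurable borel"
    unfolding g_def[abs_def] w_def[abs_def] by measurable
  have [measurable]: "h \<in> borel_measurable borel" unfolding h_def[abs_def] by measurable
  have g: "0 \<le> g \<xi>" "g \<xi> \<le> 1" for \<xi>
    unfolding g_def by (auto simp: gauss_le_1 less_imp_le[OF gauss_pos])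
  have w: "0 \<le> w \<xi>" "w \<xi> \<le> W" for \<xi>
  proof -
    have "cmod (\<Sum>p\<in>X. c p * cis (2 * pi * (p \<bullet> \<xi>))) \<le> (\<Sum>p\<in>X. \<bar>c p\<bar>)"
      by (rule order_trans[OF norm_sum]) (simp add: norm_mult)
    then show "w \<xi> \<le> W" unfolding w_def W_def by (intro power_mono) auto
  qed (simp add: w_def)
  have gint: "integrable lborel g"
    unfolding g_def[abs_def] using \<sigma> by (intro integrable_gauss_scaled) simp
  have hint: "integrable lborel h"
  proof (rule Bochner_Integration.integrable_bound)
    show "integrable lborel (\<lambda>\<xi>. W * g \<xi>)" by (intro integrable_mult_right gint)
    show "AE \<xi> in lborel. norm (h \<xi>) \<le> norm (W * g \<xi>)"
      using w g mult_right_mono[OF w(2) g(1)]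
      by (intro AE_I2) (simp add: h_def abs_mult mult.commute abs_of_nonneg[OF order_trans[OF w]])
  qed simp
  have h2int: "integrable lborel (\<lambda>\<xi>. (h \<xi>)\<^sup>2)"
  proof (rule Bochner_Integration.integrable_bound)
    show "integrable lborel (\<lambda>\<xi>. W * h \<xi>)" by (intro integrable_mult_right hint)
    have "h \<xi> * h \<xi> \<le> W * h \<xi>" for \<xi>
    proof (rule mult_right_mono)
      have "g \<xi> * w \<xi> \<le> 1 * W" using g w by (intro mult_mono) auto
      then show "h \<xi> \<le> W" by (simp add: h_def)
    qed (simp add: h_def g w)
    then show "AE \<xi> in lborel. norm ((h \<xi>)\<^sup>2) \<le> norm (W * h \<xi>)"
      by (intro AE_I2) (simp add: power2_eq_square, meson abs_ge_self order_trans)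
  qed simp
  obtain K where K: "0 < K" "\<And>z :: 'a.
    (\<integral>\<xi>. complex_of_real (g \<xi>) * cis (2 * pi * (z \<bullet> \<xi>)) \<partial>lborel) = complex_of_real (K * gauss (z /\<^sub>R \<sigma>))"
    unfolding g_def using fourier_gauss_scaled_obtain[OF \<sigma>] by metis
  \<comment> \<open>\<open>inner\<close> shows \<open>S\<close> to be the transform of
    \<open>h\<close>: multiplying \<open>g\<close> by the phase of \<open>p - q\<close> translates
    its Gaussian transform.\<close>
  define S where "S x = (\<Sum>p\<in>X. \<Sum>q\<in>X. c p * c q * (K * gauss ((p - q - x) /\<^sub>R \<sigma>)))" for x
  have [measurable]: "S \<in> borel_measurable borel" unfolding S_def[abs_def] by measurable
  have inner: "(\<integral>\<xi>. h \<xi> * cis (- 2 * pi * (x \<bullet> \<xi>)) \<partial>lborel) = complex_of_real (S x)" for x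
  proof -
    have int: "integrable lborel (\<lambda>\<xi>. complex_of_real (g \<xi>) * cis (2 * pi * (z \<bullet> \<xi>)))" for z
      by (rule Bochner_Integration.integrable_bound[OF gint]) (auto simp: norm_mult)
    have "complex_of_real (h \<xi>) * cis (- 2 * pi * (x \<bullet> \<xi>)) = (\<Sum>p\<in>X. \<Sum>q\<in>X. complex_of_real (c p * c q) *
        (complex_of_real (g \<xi>) * cis (2 * pi * ((p - q - x) \<bullet> \<xi>))))" for \<xi>
    proof -
      have "cis (2 * pi * ((p - q - x) \<bullet> \<xi>)) = cis (2 * pi * ((p - q) \<bullet> \<xi>)) * cis (- 2 * pi * (x \<bullet> \<xi>))" for p q
        by (simp add: cis_mult inner_diff_left algebra_simps)
      then show ?thesis
        unfolding h_def w_def of_real_mult[of "g \<xi>"] cmod_sum_cis_squared sum_distrib_left sum_distrib_right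
        by (simp only: mult.assoc mult.left_commute)
    qed
    then show ?thesis
      by (simp only: S_def of_real_sum of_real_mult[of "c _ * c _"] K(2)[symmetric]
          Bochner_Integration.integral_sum Bochner_Integration.integrable_sum
          integral_mult_right_zero integrable_mult_right int)
  qed
  have gaussint: "integrable lborel (\<lambda>x. gauss ((a - x) /\<^sub>R \<sigma>))" for a :: 'a
    using lborel_integrable_affine[of "gauss :: 'a \<Rightarrow> real" "- (1 / \<sigma>)" "a /\<^sub>R \<sigma>"] \<sigma> integrable_gauss
    by (simp add: scaleR_diff_right inverse_eq_divide)
  have bint: "integrable lborel (\<lambda>x. \<rho> x * f x)"
    if "integrable lborel f" for f :: "'a \<Rightarrow> real"
  proof (rule Bochner_Integration.integrable_bound)
    show "integrable lborel (\<lambda>x. M * f x)" by (intro integrable_mult_right that)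
    show "(\<lambda>x. \<rho> x * f x) \<in> borel_measurable lborel"
      using borel_measurable_integrable[OF that] by simp
    have "\<bar>\<rho> x\<bar> \<le> \<bar>M\<bar>" for x using bdd[of x] by linarith
    then show "AE x in lborel. norm (\<rho> x * f x) \<le> norm (M * f x)"
      by (intro AE_I2) (simp add: abs_mult mult_right_mono)
  qed
  have Sint: "integrable lborel S"
    unfolding S_def[abs_def]
    by (intro Bochner_Integration.integrable_sum integrable_mult_right gaussint)
  \<comment> \<open>Since \<open>S\<close> is integrable and \<rho> bounded, dominated convergence
    removes the truncation as the radius grows.\<close>
  have "((\<lambda>R. (\<integral>x. indicator (cball 0 R) x *\<^sub>R (\<rho> x * S x) \<partial>lborel)) \<longlongrightarrow> (\<integral>x. \<rho> x * S x \<partial>lborel)) at_top"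
  proof (rule integral_dominated_convergence_at_top[where w="\<lambda>x. \<bar>\<rho> x * S x\<bar>"])
    show "AE x in lborel. ((\<lambda>R. indicator (cball 0 R) x *\<^sub>R (\<rho> x * S x)) \<longlongrightarrow> \<rho> x * S x) at_top"
    proof (intro AE_I2 tendsto_eventually)
      fix x :: 'a
      show "\<forall>\<^sub>F R in at_top. indicator (cball 0 R) x *\<^sub>R (\<rho> x * S x) = \<rho> x * S x"
        using eventually_ge_at_top[of "norm x"] by eventually_elim simp
    qed
    show "\<forall>\<^sub>F R in at_top. AE x in lborel. norm (indicator (cball 0 R) x *\<^sub>R (\<rho> x * S x)) \<le> \<bar>\<rho> x * S x\<bar>"
      by (intro always_eventually allI AE_I2) (simp split: split_indicator)
    have [measurable]: "cball (0::'a) R \<in> sets borel" for R by simp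
    show "(\<lambda>x. indicator (cball 0 R) x *\<^sub>R (\<rho> x * S x)) \<in> borel_measurable lborel" for R
      by measurable
  qed (use bint[OF Sint] in auto)
  moreover have "Re (\<integral>\<xi>. truncated_fourier \<rho> R \<xi> * h \<xi> \<partial>lborel)
      = (\<integral>x. indicator (cball 0 R) x *\<^sub>R (\<rho> x * S x) \<partial>lborel)" for R
  proof -
    have "(\<integral>\<xi>. truncated_fourier \<rho> R \<xi> * h \<xi> \<partial>lborel)
        = (\<integral>x. complex_of_real (indicator (cball 0 R) x *\<^sub>R (\<rho> x * S x)) \<partial>lborel)"
      unfolding weighted_fourier_integral(2)[OF \<rho> bdd hint] inner
      by (intro Bochner_Integration.integral_cong refl) (simp split: split_indicator)
    also have "\<dots> = complex_of_real (\<integral>x. indicator (cball 0 R) x *\<^sub>R (\<rho> x * S x) \<partial>lborel)"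
      by (rule integral_complex_of_real)
    finally show ?thesis by simp
  qed
  ultimately have lim: "((\<lambda>R. Re (\<integral>\<xi>. truncated_fourier \<rho> R \<xi> * h \<xi> \<partial>lborel)) \<longlongrightarrow> (\<integral>x. \<rho> x * S x \<partial>lborel)) at_top"
    by presburger
  have "0 \<le> h \<xi>" for \<xi> by (simp add: h_def g w)
  from fourier_limit_nonneg[OF \<rho> bdd F pos hint h2int this lim]
  have "0 \<le> (\<integral>x. \<rho> x * S x \<partial>lborel)" .
  also have "(\<integral>x. \<rho> x * S x \<partial>lborel)
      = (\<Sum>p\<in>X. \<Sum>q\<in>X. c p * c q * K * (\<integral>x. \<rho> x * gauss ((p - q - x) /\<^sub>R \<sigma>) \<partial>lborel))"
  proof -
    have "\<rho> x * S x = (\<Sum>p\<in>X. \<Sum>q\<in>X. c p * c q * K * (\<rho> x * gauss ((p - q - x) /\<^sub>R \<sigma>)))" for x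
      by (simp add: S_def sum_distrib_left mult_ac)
    then show ?thesis
      by (simp only: Bochner_Integration.integral_sum Bochner_Integration.integrable_sum
          integral_mult_right_zero integrable_mult_right bint gaussint)
  qed
  \<comment> \<open>The substitution \<open>x = p - q - \<sigma> *\<^sub>R u\<close> has Jacobian
    \<open>\<sigma> ^ DIM('a)\<close>, a positive factor that is divided out together with
    \<open>K\<close>.\<close>
  also have "\<dots> = (\<Sum>p\<in>X. \<Sum>q\<in>X. c p * c q * K * (\<sigma> ^ DIM('a) * (\<integral>u. \<rho> (p - q - \<sigma> *\<^sub>R u) * gauss u \<partial>lborel)))"
  proof (intro sum.cong refl arg_cong2[where f="(*)"])
    fix p q
    show "(\<integral>x. \<rho> x * gauss ((p - q - x) /\<^sub>R \<sigma>) \<partial>lborel)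
        = \<sigma> ^ DIM('a) * (\<integral>u. \<rho> (p - q - \<sigma> *\<^sub>R u) * gauss u \<partial>lborel)"
      using lborel_integral_affine[of "\<lambda>x. \<rho> x * gauss ((p - q - x) /\<^sub>R \<sigma>)" "- \<sigma>" "p - q"] \<sigma>
      by (simp add: field_simps)
  qed
  also have "\<dots> = K * \<sigma> ^ DIM('a) *
      (\<Sum>p\<in>X. \<Sum>q\<in>X. c p * c q * (\<integral>u. \<rho> (p - q - \<sigma> *\<^sub>R u) * gauss u \<partial>lborel))"
    by (simp add: sum_distrib_left mult_ac)
  finally show ?thesis
    using K(1) \<sigma> by (meson mult_pos_neg mult_pos_pos not_le zero_less_power)
qed

text \<open>The Gaussian has total mass 1 and \<open>M * gauss u\<close> dominates the integrands,
  so pointwise convergence, which is continuity of \<rho> at \<open>a\<close>, suffices.\<close>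

lemma mollified_kernel_tendsto:
  fixes \<rho> :: "'a::euclidean_space \<Rightarrow> real"
  assumes \<rho>: "continuous_on UNIV \<rho>" and bdd: "\<And>x. \<bar>\<rho> x\<bar> \<le> M"
  shows "(\<lambda>n. \<integral>u. \<rho> (a - inverse (real (Suc n)) *\<^sub>R u) * gauss u \<partial>lborel) \<longlonglongrightarrow> \<rho> a"
proof -
  have [measurable]: "\<rho> \<in> borel_measurable borel" by (rule borel_measurable_continuous_onI[OF \<rho>])
  have "(\<lambda>n. \<integral>u. \<rho> (a - inverse (real (Suc n)) *\<^sub>R u) * gauss u \<partial>lborel) \<longlonglongrightarrow> (\<integral>u. \<rho> a * gauss (u::'a) \<partial>lborel)"
  proof (rule integral_dominated_convergence[where w="\<lambda>u::'a. M * gauss u"])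
    show "AE u in lborel. (\<lambda>n. \<rho> (a - inverse (real (Suc n)) *\<^sub>R u) * gauss u) \<longlonglongrightarrow> \<rho> a * gauss u"
    proof (intro AE_I2 tendsto_mult tendsto_const)
      fix u
      have "(\<lambda>n. a - inverse (real (Suc n)) *\<^sub>R u) \<longlonglongrightarrow> a - 0 *\<^sub>R u"
        by (intro tendsto_intros LIMSEQ_inverse_real_of_nat)
      then show "(\<lambda>n. \<rho> (a - inverse (real (Suc n)) *\<^sub>R u)) \<longlonglongrightarrow> \<rho> a"
        using \<rho> by (intro isCont_tendsto_compose[of a \<rho>]) (auto simp: continuous_on_eq_continuous_at)
    qed
    show "AE u in lborel. norm (\<rho> (a - inverse (real (Suc n)) *\<^sub>R u) * gauss u) \<le> M * gauss u" for n
      using bdd by (intro AE_I2) (simp add: abs_mult abs_of_pos[OF gauss_pos] mult_right_mono less_imp_le[OF gauss_pos])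
  qed (simp_all add: integrable_gauss)
  then show ?thesis by (simp add: integral_gauss)
qed

text \<open>The easy direction of Bochner's theorem. Fourier inversion would presuppose an
  integrable \<open>\<rho>hat\<close>; instead kernels smoothed at width \<open>1 / (n + 1)\<close>
  are used and the width is sent to 0.\<close>

theorem fourier_nonneg_imp_positive_definite:
  fixes \<rho> :: "'a::euclidean_space \<Rightarrow> real"
  assumes \<rho>: "continuous_on UNIV \<rho>" and bdd: "\<And>x. \<bar>\<rho> x\<bar> \<le> M"
    and F: "is_fourier_L2 \<rho> \<rho>hat" and pos: "AE \<xi> in lborel. 0 \<le> Re (\<rho>hat \<xi>)"
    and fin: "finite X"
  shows "0 \<le> (\<Sum>p\<in>X. \<Sum>q\<in>X. c p * c q * \<rho> (p - q))"
proof (rule LIMSEQ_le_const)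
  show "(\<lambda>n. \<Sum>p\<in>X. \<Sum>q\<in>X. c p * c q * (\<integral>u. \<rho> (p - q - inverse (real (Suc n)) *\<^sub>R u) * gauss u \<partial>lborel))
      \<longlonglongrightarrow> (\<Sum>p\<in>X. \<Sum>q\<in>X. c p * c q * \<rho> (p - q))"
    by (intro tendsto_intros mollified_kernel_tendsto[OF \<rho> bdd])
  show "\<exists>N. \<forall>n\<ge>N. 0 \<le> (\<Sum>p\<in>X. \<Sum>q\<in>X. c p * c q *
      (\<integral>u. \<rho> (p - q - inverse (real (Suc n)) *\<^sub>R u) * gauss u \<partial>lborel))"
    by (intro exI allI impI mollified_kernel_positive_definite[OF _ bdd F pos fin]
        borel_measurable_continuous_onI[OF \<rho>]) simp
qed

lemma bounded_continuous_vanishing: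
  fixes f :: "'a::euclidean_space \<Rightarrow> real"
  assumes "continuous_on UNIV f" "(f \<longlongrightarrow> 0) at_infinity"
  obtains M where "\<And>x. \<bar>f x\<bar> \<le> M"
proof -
  have "\<forall>\<^sub>F x in at_infinity. \<bar>f x\<bar> < 1"
    using tendstoD[OF assms(2), of 1] by simp
  then obtain b where b: "\<And>x. b \<le> norm x \<Longrightarrow> \<bar>f x\<bar> < 1"
    by (auto simp: eventually_at_infinity)
  have "compact (f ` cball 0 b)"
    by (intro compact_continuous_image continuous_on_subset[OF assms(1)]) auto
  then obtain B where B: "\<And>x. x \<in> cball 0 b \<Longrightarrow> \<bar>f x\<bar> \<le> B"
    by (metis bounded_iff compact_imp_bounded imageI real_norm_def)
  have "\<bar>f x\<bar> \<le> max 1 B" for x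
    using b[of x] B[of x] by (cases "b \<le> norm x") auto
  then show thesis by (rule that)
qed

section \<open>Convergence of the method\<close>

text \<open>A subspace contains the whole line through \<open>x\<close> and \<open>y\<close>, so
  restricting \<open>F\<close> to it gives a convex function on all of the reals with an ordinary
  derivative at 0, whose tangent is compared with it at 1.\<close>

lemma convex_on_subspace_above_tangent:
  fixes F :: "'a::real_normed_vector \<Rightarrow> real"
  assumes S: "subspace S" and F: "convex_on S F" and x: "x \<in> S" and y: "y \<in> S"
    and D: "(F has_derivative D) (at x within S)"
  shows "D (y - x) \<le> F y - F x"
proof -
  let ?l = "\<lambda>t::real. x + t *\<^sub>R (y - x)"
  have l: "?l t \<in> S" for t
    using S x y by (intro subspace_add subspace_scale subspace_diff)
  have conv: "convex_on UNIV (\<lambda>t. F (?l t))"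
  proof (rule convex_onI)
    fix t a b :: real assume t: "0 < t" "t < 1"
    have "?l ((1 - t) *\<^sub>R a + t *\<^sub>R b) = (1 - t) *\<^sub>R ?l a + t *\<^sub>R ?l b"
      by (simp add: algebra_simps)
    then show "F (?l ((1 - t) *\<^sub>R a + t *\<^sub>R b)) \<le> (1 - t) * F (?l a) + t * F (?l b)"
      using convex_onD[OF F _ _ l[of a] l[of b], of t] t by simp
  qed simp
  have "((\<lambda>t. F (?l t)) has_derivative (\<lambda>t. D (t *\<^sub>R (y - x)))) (at 0)"
  proof (rule has_derivative_in_compose[where f = ?l])
    show "(?l has_derivative (\<lambda>t. t *\<^sub>R (y - x))) (at 0)"
    proof -
      have "bounded_linear (\<lambda>t. t *\<^sub>R (y - x))" by (rule bounded_linear_scaleR_left)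
      from has_derivative_add[OF has_derivative_const bounded_linear_imp_has_derivative[OF this]]
      show ?thesis by simp
    qed
    show "(F has_derivative D) (at (?l 0) within range ?l)"
    proof (rule has_derivative_subset)
      show "(F has_derivative D) (at (?l 0) within S)" using D by simp
    qed (use l in auto)
  qed
  moreover have "(\<lambda>t. D (t *\<^sub>R (y - x))) = (\<lambda>t. D (y - x) * t)"
    using linear_scale[OF has_derivative_linear[OF D]] by (simp add: mult.commute)
  ultimately have "((\<lambda>t. F (?l t)) has_real_derivative D (y - x)) (at 0)"
    by (simp add: has_field_derivative_def)
  from convex_on_imp_above_tangent[OF conv connected_UNIV _ _ this, of 1]
  show ?thesis by simp
qed

section \<open>Mass and norm of nonnegative measures\<close>

lemma smeas_Union:
  assumes "finite I" "\<And>i. i \<in> I \<Longrightarrow> A i \<in> sets borel" "disjoint_family_on A I"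
  shows "smeas \<mu> (\<Union>i\<in>I. A i) = (\<Sum>i\<in>I. smeas \<mu> (A i))"
proof -
  have U: "(\<Union>i\<in>I. A i) \<in> sets borel" using assms by (intro sets.finite_UN) auto
  have "A ` I \<subseteq> sets (pos_part \<mu>)" "A ` I \<subseteq> sets (neg_part \<mu>)" using assms by auto
  note m = finite_measure.finite_measure_finite_Union[OF finite_measure_pos_part assms(1) this(1) assms(3)]
    finite_measure.finite_measure_finite_Union[OF finite_measure_neg_part assms(1) this(2) assms(3)]
  show ?thesis
    using assms(2) by (simp add: jordan_decomposition(1)[OF U] jordan_decomposition(1) m sum_subtractf)
qed

lemma smeas_Un:
  assumes "A \<in> sets borel" "B \<in> sets borel" "A \<inter> B = {}"
  shows "smeas \<mu> (A \<union> B) = smeas \<mu> A + smeas \<mu> B"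
proof -
  have "disjoint_family_on (\<lambda>b. if b then A else B) {True, False}"
    using assms(3) by (auto simp: disjoint_family_on_def)
  moreover have "(if b then A else B) \<in> sets borel" for b using assms by simp
  ultimately have "smeas \<mu> (\<Union>b\<in>{True, False}. if b then A else B)
      = (\<Sum>b\<in>{True, False}. smeas \<mu> (if b then A else B))"
    by (intro smeas_Union) simp_all
  then show ?thesis by (simp add: Un_commute)
qed

text \<open>For a nonnegative measure every disjoint family sums to the measure of its union, which
  is at most the total mass.\<close>

lemma norm_nonneg_measure:
  assumes "nonneg_measure \<mu>"
  shows "norm \<mu> = smeas \<mu> UNIV"
proof (rule antisym)
  show "smeas \<mu> UNIV \<le> norm \<mu>"
    using abs_le_set_variation[OF is_signed_measure_smeas, of UNIV \<mu>]
    by (simp add: norm_signed_measure_def)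
  show "norm \<mu> \<le> smeas \<mu> UNIV"
    unfolding norm_signed_measure_def
  proof (rule set_variation_least)
    fix P :: "'a set set" assume "P \<in> borel_families UNIV"
    then have P: "finite P" "disjoint P" "P \<subseteq> sets borel" by (auto simp: borel_families_def)
    have U: "\<Union>P \<in> sets borel" using P by auto
    have "(\<Sum>B\<in>P. \<bar>smeas \<mu> B\<bar>) = (\<Sum>B\<in>P. smeas \<mu> B)"
      using P assms by (intro sum.cong) (auto simp: nonneg_measure_def)
    also have "\<dots> = smeas \<mu> (\<Union>P)"
    proof -
      have "disjoint_family_on (\<lambda>B. B) P"
        using P(2) by (simp add: disjoint_def disjoint_family_on_def)
      then show ?thesis
        using smeas_Union[OF P(1), of "\<lambda>B. B" \<mu>] P(3) by (simp add: subset_iff)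
    qed
    also have "\<dots> \<le> smeas \<mu> (\<Union>P) + smeas \<mu> (- \<Union>P)"
      using assms U by (auto simp: nonneg_measure_def)
    also have "\<dots> = smeas \<mu> UNIV"
      using smeas_Un[of "\<Union>P" "- \<Union>P" \<mu>] U by auto
    finally show "(\<Sum>B\<in>P. \<bar>smeas \<mu> B\<bar>) \<le> smeas \<mu> UNIV" .
  qed
qed

text \<open>This makes the regulariser linear: \<open>\<alpha> * norm \<mu>\<close> becomes the
  pairing of \<mu> with the constant \<alpha>, which can be added to the derivative of
  \<open>F\<close>.\<close>

lemma smeas_eq_norm:
  assumes "nonneg_measure \<mu>" "\<mu> \<in> measures_on \<Omega>" "\<Omega> \<in> sets borel"
  shows "smeas \<mu> \<Omega> = norm \<mu>"
proof -
  have "smeas \<mu> (- \<Omega>) = 0" using assms by (auto simp: measures_on_def)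
  then show ?thesis
    using smeas_Un[of \<Omega> "- \<Omega>" \<mu>] assms by (auto simp: norm_nonneg_measure)
qed

lemma subspace_measures_on: "subspace (measures_on \<Omega>)"
  unfolding subspace_def measures_on_def by simp

lemma discrete_measures_on_subset:
  assumes "\<mu> \<in> discrete_measures_on \<Omega>"
  shows "\<mu> \<in> measures_on \<Omega>"
proof -
  have "dirac ` \<Omega> \<subseteq> measures_on \<Omega>"
    by (auto simp: measures_on_def dirac.rep_eq indicator_def)
  from span_minimal[OF this subspace_measures_on] assms show ?thesis
    by (auto simp: discrete_measures_on_def)
qed

lemma objective_nonneg_measure:
  "nonneg_measure \<mu> \<Longrightarrow> objective F \<alpha> \<mu> = ereal (F \<mu> + \<alpha> * norm \<mu>)"
  by (simp add: objective_def regulariser_def)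

section \<open>The inner product of the kernel and one step of the method\<close>

locale convolution_kernel =
  fixes \<Omega> :: "'a::euclidean_space set" and \<rho> :: "'a \<Rightarrow> real"
  assumes compact: "compact \<Omega>" and continuous: "continuous_on UNIV \<rho>"
    and even: "\<And>y. \<rho> (- y) = \<rho> y"
    and positive_definite: "\<And>X c. finite X \<Longrightarrow> 0 \<le> (\<Sum>p\<in>X. \<Sum>q\<in>X. c p * c q * \<rho> (p - q))"
begin

definition D_inner :: "'a signed_measure \<Rightarrow> 'a signed_measure \<Rightarrow> real" where
  "D_inner \<mu> \<nu> = pairing \<Omega> (conv_measure \<Omega> \<rho> \<mu>) \<nu>"

lemmas continuous_on_conv = continuous_on_conv_measure[OF compact continuous]

lemma D_inner_sym: "D_inner \<mu> \<nu> = D_inner \<nu> \<mu>"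
  unfolding D_inner_def by (rule conv_pairing_sym[OF compact continuous even])

lemma D_inner_diff_right: "D_inner \<mu> (\<nu> - \<nu>') = D_inner \<mu> \<nu> - D_inner \<mu> \<nu>'"
  unfolding D_inner_def by (rule pairing_diff_measure[OF compact continuous_on_conv])

lemma D_inner_diff_left: "D_inner (\<mu> - \<mu>') \<nu> = D_inner \<mu> \<nu> - D_inner \<mu>' \<nu>"
  using D_inner_diff_right[of \<nu> \<mu> \<mu>'] by (simp only: D_inner_sym[of _ \<nu>])

text \<open>Semidefiniteness enters here: squaring undoes the root in \<open>D_norm\<close> because
  the radicand is nonnegative.\<close>

lemma D_norm_squared: "(D_norm \<Omega> \<rho> \<mu>)\<^sup>2 = D_inner \<mu> \<mu>"
  unfolding D_norm_def D_inner_def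
  by (intro real_sqrt_pow2 conv_pairing_nonneg[OF compact continuous positive_definite])

lemma three_point_identity:
  "2 * D_inner (\<mu>' - \<mu>) (\<mu>' - \<nu>)
    = (D_norm \<Omega> \<rho> (\<mu>' - \<mu>))\<^sup>2 + (D_norm \<Omega> \<rho> (\<mu>' - \<nu>))\<^sup>2 - (D_norm \<Omega> \<rho> (\<mu> - \<nu>))\<^sup>2"
  unfolding D_norm_squared D_inner_diff_left D_inner_diff_right
  using D_inner_sym[of \<mu> \<mu>'] D_inner_sym[of \<nu> \<mu>'] D_inner_sym[of \<nu> \<mu>] by simp

lemma residual_pairing:
  assumes "continuous_on \<Omega> v"
  shows "continuous_on \<Omega> (\<lambda>x. \<tau> * (v x + \<alpha>) + conv_measure \<Omega> \<rho> \<delta> x)"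
    and "pairing \<Omega> (\<lambda>x. \<tau> * (v x + \<alpha>) + conv_measure \<Omega> \<rho> \<delta> x) \<nu>
      = \<tau> * (pairing \<Omega> v \<nu> + \<alpha> * smeas \<nu> \<Omega>) + D_inner \<delta> \<nu>"
proof -
  show "continuous_on \<Omega> (\<lambda>x. \<tau> * (v x + \<alpha>) + conv_measure \<Omega> \<rho> \<delta> x)"
    by (intro continuous_intros assms continuous_on_conv)
  \<comment> \<open>The factors \<open>1 *\<close> give the residual the shape of the linear
    combinations in \<open>pairing_lincomb_fun\<close>, which is applied twice.\<close>
  have c: "continuous_on \<Omega> (\<lambda>x. 1 * v x + 1 * \<alpha>)" by (intro continuous_intros assms)
  have "pairing \<Omega> (\<lambda>x. \<tau> * (1 * v x + 1 * \<alpha>) + 1 * conv_measure \<Omega> \<rho> \<delta> x) \<nu>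
      = \<tau> * (1 * pairing \<Omega> v \<nu> + 1 * pairing \<Omega> (\<lambda>_. \<alpha>) \<nu>) + 1 * D_inner \<delta> \<nu>"
    unfolding D_inner_def
    by (subst pairing_lincomb_fun[OF compact c continuous_on_conv],
        subst pairing_lincomb_fun[OF compact assms continuous_on_const]) (rule refl)
  then show "pairing \<Omega> (\<lambda>x. \<tau> * (v x + \<alpha>) + conv_measure \<Omega> \<rho> \<delta> x) \<nu>
      = \<tau> * (pairing \<Omega> v \<nu> + \<alpha> * smeas \<nu> \<Omega>) + D_inner \<delta> \<nu>"
    by (simp add: pairing_const[OF compact])
qed

text \<open>Testing the residual with \<open>\<mu>'\<close> from above and with \<nu> from below
  bounds the change of the linearised objective, up to an inner product that the three-point
  identity expands. The squared step in that identity absorbs the smoothness error because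
  \<open>\<tau> * L \<le> 1\<close>.\<close>

lemma muFB_step:
  assumes convex: "convex_on (measures_on \<Omega>) F" and F': "pre_derivative \<Omega> F F'"
    and smooth: "F \<mu>' - F \<mu> - pairing \<Omega> (F' \<mu>) (\<mu>' - \<mu>) \<le> L / 2 * (D_norm \<Omega> \<rho> (\<mu>' - \<mu>))\<^sup>2"
    and \<tau>: "0 < \<tau>" "\<tau> * L \<le> 1"
    and mem: "\<mu> \<in> measures_on \<Omega>" "\<mu>' \<in> measures_on \<Omega>" "\<nu> \<in> measures_on \<Omega>"
    and nonneg: "nonneg_measure \<mu>'" "nonneg_measure \<nu>"
    and lower: "\<And>x. x \<in> \<Omega> \<Longrightarrow> - e \<le> \<tau> * (F' \<mu> x + \<alpha>) + conv_measure \<Omega> \<rho> (\<mu>' - \<mu>) x"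
    and upper: "pairing \<Omega> (\<lambda>x. \<tau> * (F' \<mu> x + \<alpha>) + conv_measure \<Omega> \<rho> (\<mu>' - \<mu>) x) \<mu>' \<le> \<kappa> * e"
  shows "\<tau> * ((F \<mu>' + \<alpha> * norm \<mu>') - (F \<nu> + \<alpha> * norm \<nu>))
    \<le> (\<kappa> + norm \<nu>) * e + (D_norm \<Omega> \<rho> (\<mu> - \<nu>))\<^sup>2 / 2 - (D_norm \<Omega> \<rho> (\<mu>' - \<nu>))\<^sup>2 / 2"
proof -
  let ?v = "F' \<mu>" and ?d = "D_norm \<Omega> \<rho> (\<mu>' - \<mu>)"
  have v: "continuous_on \<Omega> ?v" using F' mem(1) by (simp add: pre_derivative_def)
  have "(F has_derivative pairing \<Omega> ?v) (at \<mu> within measures_on \<Omega>)"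
    using F' mem(1) by (simp add: pre_derivative_def)
  from convex_on_subspace_above_tangent[OF subspace_measures_on convex mem(1,3) this]
  have tangent: "pairing \<Omega> ?v (\<nu> - \<mu>) \<le> F \<nu> - F \<mu>" .
  have \<Omega>: "\<Omega> \<in> sets borel" using compact by (rule borel_compact)
  note norms = smeas_eq_norm[OF nonneg(1) mem(2) \<Omega>] smeas_eq_norm[OF nonneg(2) mem(3) \<Omega>]
  \<comment> \<open>Integrating the pointwise lower bound against the nonnegative \<nu> costs
    \<open>e\<close> times its mass, hence the \<open>norm \<nu>\<close> in the final bound.\<close>
  have "- e * smeas \<nu> \<Omega> \<le> pairing \<Omega> (\<lambda>x. \<tau> * (?v x + \<alpha>) + conv_measure \<Omega> \<rho> (\<mu>' - \<mu>) x) \<nu>"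
    unfolding pairing_const[OF compact, symmetric]
    by (intro pairing_mono compact continuous_on_const residual_pairing(1) v nonneg lower)
  then have low: "- (norm \<nu> * e) \<le> \<tau> * (pairing \<Omega> ?v \<nu> + \<alpha> * norm \<nu>) + D_inner (\<mu>' - \<mu>) \<nu>"
    unfolding residual_pairing(2)[OF v] norms by (simp add: mult.commute)
  have up: "\<tau> * (pairing \<Omega> ?v \<mu>' + \<alpha> * norm \<mu>') + D_inner (\<mu>' - \<mu>) \<mu>' \<le> \<kappa> * e"
    using upper unfolding residual_pairing(2)[OF v] norms .
  \<comment> \<open>The difference is split at \<mu>: smoothness bounds
    \<open>F \<mu>' - F \<mu>\<close>, and the tangent inequality bounds
    \<open>F \<mu> - F \<nu>\<close>.\<close>
  have "F \<mu>' - F \<nu> \<le> pairing \<Omega> ?v \<mu>' - pairing \<Omega> ?v \<nu> + L / 2 * ?d\<^sup>2"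
    using smooth tangent unfolding pairing_diff_measure[OF compact v] by linarith
  then have "\<tau> * (F \<mu>' - F \<nu>) \<le> \<tau> * (pairing \<Omega> ?v \<mu>' - pairing \<Omega> ?v \<nu> + L / 2 * ?d\<^sup>2)"
    using \<tau>(1) by (intro mult_left_mono) auto
  moreover have "\<tau> * L * ?d\<^sup>2 \<le> 1 * ?d\<^sup>2" using \<tau>(2) by (intro mult_right_mono) auto
  ultimately have "\<tau> * (F \<mu>' - F \<nu>) \<le> \<tau> * (pairing \<Omega> ?v \<mu>' - pairing \<Omega> ?v \<nu>) + ?d\<^sup>2 / 2"
    by (simp add: algebra_simps)
  with low up three_point_identity[of \<mu>' \<mu> \<nu>] show ?thesis
    unfolding D_inner_diff_right by (simp add: algebra_simps)
qed

end

section \<open>Minimisers and ergodic averages\<close>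

lemma objective_minimiser_nonneg:
  assumes "(\<lambda>_. 0) \<in> pre_subdifferential \<Omega> (objective F \<alpha>) \<mu>"
  shows "nonneg_measure \<mu>"
proof (rule ccontr)
  assume "\<not> nonneg_measure \<mu>"
  then have "objective F \<alpha> \<mu> = \<infinity>" by (simp add: objective_def regulariser_def)
  \<comment> \<open>The zero measure is a competitor with finite objective; against it, an infinite
    value at \<mu> would make the difference minus infinity.\<close>
  moreover have "nonneg_measure (0::'a signed_measure)" by (simp add: nonneg_measure_def)
  then have "objective F \<alpha> 0 = ereal (F 0)" by (simp add: objective_nonneg_measure)
  moreover have "objective F \<alpha> 0 - objective F \<alpha> \<mu> \<ge> ereal (pairing \<Omega> (\<lambda>_. 0) (0 - \<mu>))"
    using assms subspace_0[OF subspace_measures_on] unfolding pre_subdifferential_def by blast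
  ultimately show False by simp
qed

lemma objective_minimiser_le:
  assumes "(\<lambda>_. 0) \<in> pre_subdifferential \<Omega> (objective F \<alpha>) \<mu>"
    and "\<nu> \<in> measures_on \<Omega>" "nonneg_measure \<nu>"
  shows "F \<mu> + \<alpha> * norm \<mu> \<le> F \<nu> + \<alpha> * norm \<nu>"
proof -
  have "objective F \<alpha> \<nu> - objective F \<alpha> \<mu> \<ge> ereal (pairing \<Omega> (\<lambda>_. 0) (\<nu> - \<mu>))"
    using assms unfolding pre_subdifferential_def by blast
  then show ?thesis
    using objective_minimiser_nonneg[OF assms(1)] assms(3)
    by (simp add: objective_nonneg_measure pairing_def set_lebesgue_integral_def)
qed

text \<open>Jensen's inequality with equal weights \<open>1 / real N\<close> handles
  \<open>F\<close> and the triangle inequality handles the norm. Averages of nonnegative measures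
  stay nonnegative, so the objective stays finite.\<close>

lemma
  assumes "1 \<le> N" and "\<And>k. \<mu> (Suc k) \<in> measures_on \<Omega>" and "\<And>k. nonneg_measure (\<mu> (Suc k))"
  shows ergodic_iterate_measures_on: "ergodic_iterate \<mu> N \<in> measures_on \<Omega>"
    and nonneg_ergodic_iterate: "nonneg_measure (ergodic_iterate \<mu> N)"
    and ergodic_iterate_convex: "convex_on (measures_on \<Omega>) F \<Longrightarrow> 0 \<le> \<alpha> \<Longrightarrow>
      F (ergodic_iterate \<mu> N) + \<alpha> * norm (ergodic_iterate \<mu> N)
        \<le> 1 / real N * (\<Sum>k<N. F (\<mu> (Suc k)) + \<alpha> * norm (\<mu> (Suc k)))"
proof -
  show "ergodic_iterate \<mu> N \<in> measures_on \<Omega>"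
    unfolding ergodic_iterate_def
    by (intro subspace_scale subspace_sum subspace_measures_on assms)
  show "nonneg_measure (ergodic_iterate \<mu> N)"
    using assms(3) by (auto simp: nonneg_measure_def ergodic_iterate_def smeas_sum sum_nonneg)
  assume F: "convex_on (measures_on \<Omega>) F" and \<alpha>: "0 \<le> \<alpha>"
  have "F (\<Sum>k<N. (1 / real N) *\<^sub>R \<mu> (Suc k)) \<le> (\<Sum>k<N. 1 / real N * F (\<mu> (Suc k)))"
    using assms by (intro convex_on_sum[OF _ _ F]) (auto simp: lessThan_empty_iff)
  then have "F (ergodic_iterate \<mu> N) \<le> 1 / real N * (\<Sum>k<N. F (\<mu> (Suc k)))"
    by (simp add: ergodic_iterate_def scaleR_sum_right sum_distrib_left)
  moreover have "norm (ergodic_iterate \<mu> N) \<le> 1 / real N * (\<Sum>k<N. norm (\<mu> (Suc k)))"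
    unfolding ergodic_iterate_def by (simp add: divide_right_mono norm_sum)
  from mult_left_mono[OF this \<alpha>]
  have "\<alpha> * norm (ergodic_iterate \<mu> N) \<le> 1 / real N * (\<Sum>k<N. \<alpha> * norm (\<mu> (Suc k)))"
    by (simp add: sum_distrib_left mult.left_commute)
  ultimately show "F (ergodic_iterate \<mu> N) + \<alpha> * norm (ergodic_iterate \<mu> N)
        \<le> 1 / real N * (\<Sum>k<N. F (\<mu> (Suc k)) + \<alpha> * norm (\<mu> (Suc k)))"
    by (simp add: sum.distrib distrib_left)
qed

theorem theorem4p10:
  fixes \<Omega> :: "(real ^ 'n) set"
    and \<rho> :: "real ^ 'n \<Rightarrow> real"
    and \<rho>hat :: "real ^ 'n \<Rightarrow> complex"
    and F :: "(real ^ 'n) signed_measure \<Rightarrow> real"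
    and F' :: "(real ^ 'n) signed_measure \<Rightarrow> real ^ 'n \<Rightarrow> real"
    and \<mu> :: "nat \<Rightarrow> (real ^ 'n) signed_measure"
    and \<mu>bar :: "(real ^ 'n) signed_measure"
    and \<epsilon> :: "nat \<Rightarrow> real"
    and \<alpha> L \<tau> \<kappa> :: real
  assumes "compact \<Omega>" and "\<alpha> > 0"
    and "continuous_on UNIV \<rho>" and "(\<rho> \<longlongrightarrow> 0) at_infinity"
    and "integrable lborel (\<lambda>x. (\<rho> x)\<^sup>2)"
    and "\<exists>x. \<rho> x \<noteq> 0"
    and "\<And>y. \<rho> (- y) = \<rho> y"
    and "is_fourier_L2 \<rho> \<rho>hat"
    and "AE \<xi> in lborel. \<rho>hat \<xi> \<in> \<real> \<and> 0 \<le> Re (\<rho>hat \<xi>)"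
    and "convex_on (measures_on \<Omega>) F"
    and "pre_derivative \<Omega> F F'"
    and "L \<ge> 0"
    and "\<And>\<nu> \<mu>. \<nu> \<in> measures_on \<Omega> \<Longrightarrow> \<mu> \<in> measures_on \<Omega> \<Longrightarrow>
           F \<nu> - F \<mu> - pairing \<Omega> (F' \<mu>) (\<nu> - \<mu>) \<le> L / 2 * (D_norm \<Omega> \<rho> (\<nu> - \<mu>))\<^sup>2"
    and "\<tau> > 0" and "\<tau> * L \<le> 1"
    and "\<mu>bar \<in> measures_on \<Omega>"
    and "(\<lambda>_. 0) \<in> pre_subdifferential \<Omega> (objective F \<alpha>) \<mu>bar"
    and "0 < \<kappa>" and "\<kappa> < 1"
    and "\<And>k. \<epsilon> (Suc k) > 0"
    and "muFB_sequence \<Omega> \<rho> \<alpha> \<tau> \<kappa> \<epsilon> F' \<mu>"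
    and "(\<lambda>N. 1 / real N * (\<Sum>k<N. \<epsilon> (Suc k))) \<longlonglongrightarrow> 0"
  shows "(\<lambda>N. objective F \<alpha> (ergodic_iterate \<mu> N)) \<longlonglongrightarrow> objective F \<alpha> \<mu>bar \<and>
    (\<forall>N\<ge>1. objective F \<alpha> (ergodic_iterate \<mu> N) \<le> objective F \<alpha> \<mu>bar +
       ereal (1 / (real N * \<tau>) *
         ((\<kappa> + norm \<mu>bar) * (\<Sum>k<N. \<epsilon> (Suc k)) + 1 / 2 * (D_norm \<Omega> \<rho> (\<mu> 0 - \<mu>bar))\<^sup>2)))"
proof -
  obtain M where M: "\<And>x. \<bar>\<rho> x\<bar> \<le> M"
    using bounded_continuous_vanishing[OF assms(3,4)] by blast
  have pos: "AE \<xi> in lborel. 0 \<le> Re (\<rho>hat \<xi>)" using assms(9) by eventually_elim simp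
  \<comment> \<open>The assumption on the Fourier transform enters through positive definiteness of
    the kernel.\<close>
  interpret convolution_kernel \<Omega> \<rho>
    by standard
      (use assms(1,3,7) fourier_nonneg_imp_positive_definite[OF assms(3) M assms(8) pos] in auto)
  let ?J = "\<lambda>\<nu>. F \<nu> + \<alpha> * norm \<nu>"
  let ?B = "\<lambda>N. 1 / (real N * \<tau>) *
    ((\<kappa> + norm \<mu>bar) * (\<Sum>k<N. \<epsilon> (Suc k)) + 1 / 2 * (D_norm \<Omega> \<rho> (\<mu> 0 - \<mu>bar))\<^sup>2)"
  note seq = \<open>muFB_sequence \<Omega> \<rho> \<alpha> \<tau> \<kappa> \<epsilon> F' \<mu>\<close>[unfolded muFB_sequence_def muFB_residual_def[abs_def]]
  have mem: "\<mu> k \<in> measures_on \<Omega>" for k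
    using seq by (cases k) (auto intro: discrete_measures_on_subset)
  \<comment> \<open>\<open>\<mu> 0\<close> may be a signed measure; the ergodic iterate averages
    from \<open>\<mu> 1\<close> on.\<close>
  have nonneg: "nonneg_measure (\<mu> (Suc k))" for k using seq by auto
  have bar: "nonneg_measure \<mu>bar" by (rule objective_minimiser_nonneg[OF assms(17)])
  have step: "\<tau> * (?J (\<mu> (Suc k)) - ?J \<mu>bar) \<le> (\<kappa> + norm \<mu>bar) * \<epsilon> (Suc k)
      + (D_norm \<Omega> \<rho> (\<mu> k - \<mu>bar))\<^sup>2 / 2 - (D_norm \<Omega> \<rho> (\<mu> (Suc k) - \<mu>bar))\<^sup>2 / 2" for k
    using seq
    by (intro muFB_step[OF assms(10,11,13) assms(14,15) mem mem assms(16) nonneg bar] mem) auto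
  \<comment> \<open>Summing the step inequality telescopes the squared distances to the
    minimiser.\<close>
  have total: "\<tau> * (\<Sum>k<N. ?J (\<mu> (Suc k)) - ?J \<mu>bar) \<le> (\<kappa> + norm \<mu>bar) * (\<Sum>k<N. \<epsilon> (Suc k))
      + (D_norm \<Omega> \<rho> (\<mu> 0 - \<mu>bar))\<^sup>2 / 2 - (D_norm \<Omega> \<rho> (\<mu> N - \<mu>bar))\<^sup>2 / 2" for N
  proof (induction N)
    case (Suc N)
    then show ?case using step[of N] by (simp add: distrib_left)
  qed simp
  have upper: "?J (ergodic_iterate \<mu> N) \<le> ?J \<mu>bar + ?B N" if "1 \<le> N" for N
  proof -
    have "?J (ergodic_iterate \<mu> N) \<le> 1 / real N * (\<Sum>k<N. ?J (\<mu> (Suc k)))"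
      using that assms(2,10) mem nonneg by (intro ergodic_iterate_convex) auto
    also have "\<dots> = ?J \<mu>bar + 1 / (real N * \<tau>) * (\<tau> * (\<Sum>k<N. ?J (\<mu> (Suc k)) - ?J \<mu>bar))"
      using that assms(14) by (simp add: sum_subtractf field_simps)
    also have "\<dots> \<le> ?J \<mu>bar + ?B N"
    proof (intro add_left_mono mult_left_mono)
      \<comment> \<open>The last squared distance is nonnegative and is dropped.\<close>
      show "\<tau> * (\<Sum>k<N. ?J (\<mu> (Suc k)) - ?J \<mu>bar) \<le> (\<kappa> + norm \<mu>bar) * (\<Sum>k<N. \<epsilon> (Suc k))
          + 1 / 2 * (D_norm \<Omega> \<rho> (\<mu> 0 - \<mu>bar))\<^sup>2"
        using total[of N] zero_le_power2[of "D_norm \<Omega> \<rho> (\<mu> N - \<mu>bar)"] by linarith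
    qed (use assms(14) in simp)
    finally show ?thesis .
  qed
  have erg: "objective F \<alpha> (ergodic_iterate \<mu> N) = ereal (?J (ergodic_iterate \<mu> N))" if "1 \<le> N" for N
    using that mem nonneg by (intro objective_nonneg_measure nonneg_ergodic_iterate) auto
  have lower: "?J \<mu>bar \<le> ?J (ergodic_iterate \<mu> N)" if "1 \<le> N" for N
    using that mem nonneg
    by (intro objective_minimiser_le[OF assms(17)] ergodic_iterate_measures_on nonneg_ergodic_iterate) auto
  \<comment> \<open>The bound is regrouped as a multiple of the mean tolerance plus a multiple of
    \<open>1 / real N\<close>, both of which tend to 0.\<close>
  have "(\<lambda>N. ?J \<mu>bar + ((\<kappa> + norm \<mu>bar) / \<tau> * (1 / real N * (\<Sum>k<N. \<epsilon> (Suc k)))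
      + (D_norm \<Omega> \<rho> (\<mu> 0 - \<mu>bar))\<^sup>2 / (2 * \<tau>) * (1 / real N))) \<longlonglongrightarrow>
      ?J \<mu>bar + ((\<kappa> + norm \<mu>bar) / \<tau> * 0 + (D_norm \<Omega> \<rho> (\<mu> 0 - \<mu>bar))\<^sup>2 / (2 * \<tau>) * 0)"
    by (intro tendsto_intros assms(22) lim_1_over_n)
  also have "(\<lambda>N. ?J \<mu>bar + ((\<kappa> + norm \<mu>bar) / \<tau> * (1 / real N * (\<Sum>k<N. \<epsilon> (Suc k)))
      + (D_norm \<Omega> \<rho> (\<mu> 0 - \<mu>bar))\<^sup>2 / (2 * \<tau>) * (1 / real N))) = (\<lambda>N. ?J \<mu>bar + ?B N)"
  proof
    fix N
    show "?J \<mu>bar + ((\<kappa> + norm \<mu>bar) / \<tau> * (1 / real N * (\<Sum>k<N. \<epsilon> (Suc k)))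
      + (D_norm \<Omega> \<rho> (\<mu> 0 - \<mu>bar))\<^sup>2 / (2 * \<tau>) * (1 / real N)) = ?J \<mu>bar + ?B N"
      \<comment> \<open>At \<open>N = 0\<close> both sides are \<open>?J \<mu>bar\<close>, as
        division by zero yields 0.\<close>
      using assms(14) by (cases "N = 0") (simp_all add: field_simps)
  qed
  finally have "(\<lambda>N. ?J \<mu>bar + ?B N) \<longlonglongrightarrow> ?J \<mu>bar" by simp
  \<comment> \<open>Minimality of \<open>\<mu>bar\<close> gives the lower half of the sandwich, the
    quantitative estimate the upper half.\<close>
  with tendsto_const[of "?J \<mu>bar" sequentially] have "(\<lambda>N. ?J (ergodic_iterate \<mu> N)) \<longlonglongrightarrow> ?J \<mu>bar"
    by (rule tendsto_sandwich[rotated 2])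
      (use lower upper in \<open>auto simp: eventually_sequentially\<close>)
  then have "(\<lambda>N. ereal (?J (ergodic_iterate \<mu> N))) \<longlonglongrightarrow> objective F \<alpha> \<mu>bar"
    unfolding objective_nonneg_measure[OF bar] by (rule tendsto_ereal)
  then have "(\<lambda>N. objective F \<alpha> (ergodic_iterate \<mu> N)) \<longlonglongrightarrow> objective F \<alpha> \<mu>bar"
    by (rule Lim_transform_eventually) (use erg in \<open>auto simp: eventually_sequentially intro!: exI[of _ 1]\<close>)
  moreover have "objective F \<alpha> (ergodic_iterate \<mu> N) \<le> objective F \<alpha> \<mu>bar + ereal (?B N)" if "1 \<le> N" for N
    unfolding objective_nonneg_measure[OF bar] erg[OF that] using upper[OF that] by simp
  ultimately show ?thesis by blast
qed

end
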